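(* Let $g_0=dr^2+f(r)^2d\theta^2$ be a smooth rotationally symmetric metric on $M=\mathbb{S}^1\times[-\rho,\rho]$ with $A_{g_0}(M)=1$, $R_{g_0}\ge0$, $k_{g_0}\le0$, which is symmetric under the reflection $r\mapsto -r$ and whose scalar curvature is decreasing from the middle, i.e. $R_{g_0}$, as a function of $r$, is nonincreasing in $|r|$. Then along the normalised flow $g(t)$ starting at $g_0$ there is a sequence $t_k\to\infty$ with $\max_M R(\cdot,t_k)\to0$.
   Context: The middle parallel is $\mathbb{S}^1\times\{0\}$. $R$ denotes scalar curvature, $k_g$ the geodesic curvature of $\partial M$ w.r.t. the outward normal. The unnormalised flow solves $\partial_{\tilde t}\tilde g=-\tilde R\tilde g$, $k_{\tilde g}=k_{g_0}$ on $\partial M$, $\tilde g(0)=g_0$. The normalised flow is $g=\phi\tilde g$ with $\phi(\tilde t)$ chosen so that $A_g(M)=1$, reparametrised by $t=\int_0^{\tilde t}\phi(\tau)d\tau$; it solves $\partial_t g=(r-R)g$, $k_g=k_{g_0}/\sqrt{\phi}$ on $\partial M$, $g(0)=g_0$, with $r=\int_M R\,dA_g$; it exists for all time. Rotational symmetry, reflection symmetry and the property of curvature decreasing from the middle are preserved by the flow. *)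

theory Defs
  imports "HOL-Analysis.Analysis"
begin

definition smooth1_on :: "real set \<Rightarrow> (real \<Rightarrow> real) \<Rightarrow> bool" where
  "smooth1_on U h \<longleftrightarrow>
     (\<exists>D :: nat \<Rightarrow> real \<Rightarrow> real. D 0 = h \<and>
        (\<forall>k. \<forall>x\<in>U. (D k has_real_derivative D (Suc k) x) (at x)))"

definition smooth2_on :: "(real \<times> real) set \<Rightarrow> (real \<Rightarrow> real \<Rightarrow> real) \<Rightarrow> bool" where
  "smooth2_on U h \<longleftrightarrow>
     (\<exists>D :: nat \<Rightarrow> nat \<Rightarrow> real \<Rightarrow> real \<Rightarrow> real. D 0 0 = h \<and>
        (\<forall>i j. \<forall>p\<in>U.
           ((\<lambda>q. D i j (fst q) (snd q)) has_derivative
              (\<lambda>q. fst q * D (Suc i) j (fst p) (snd p) + snd q * D i (Suc j) (fst p) (snd p))) (at p)))"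

text \<open>Rotationally symmetric metric  A(r)^2 dr^2 + B(r)^2 d theta^2  on S^1 x [-rho,rho].
  Scalar curvature R = 2K with Gaussian curvature K = -(1/(A B)) (B'/A)'.\<close>
definition rs_scal :: "(real \<Rightarrow> real) \<Rightarrow> (real \<Rightarrow> real) \<Rightarrow> real \<Rightarrow> real" where
  "rs_scal A B r = - 2 / (A r * B r) * deriv (\<lambda>s. deriv B s / A s) r"

definition rs_area :: "(real \<Rightarrow> real) \<Rightarrow> (real \<Rightarrow> real) \<Rightarrow> real \<Rightarrow> real" where
  "rs_area A B \<rho> = 2 * pi * integral {-\<rho>..\<rho>} (\<lambda>r. A r * B r)"

definition rs_total_scal :: "(real \<Rightarrow> real) \<Rightarrow> (real \<Rightarrow> real) \<Rightarrow> real \<Rightarrow> real" where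
  "rs_total_scal A B \<rho> = 2 * pi * integral {-\<rho>..\<rho>} (\<lambda>r. rs_scal A B r * A r * B r)"

text \<open>Geodesic curvature of the boundary circles w.r.t. the outward normal
  (outward normal (1/A) d_r at r = rho and -(1/A) d_r at r = -rho).\<close>
definition rs_geod_top :: "(real \<Rightarrow> real) \<Rightarrow> (real \<Rightarrow> real) \<Rightarrow> real \<Rightarrow> real" where
  "rs_geod_top A B \<rho> = deriv B \<rho> / (A \<rho> * B \<rho>)"

definition rs_geod_bot :: "(real \<Rightarrow> real) \<Rightarrow> (real \<Rightarrow> real) \<Rightarrow> real \<Rightarrow> real" where
  "rs_geod_bot A B \<rho> = - deriv B (-\<rho>) / (A (-\<rho>) * B (-\<rho>))"

text \<open>The metric g(t) = e^{2 u(r,t)} g_0 with g_0 = dr^2 + f(r)^2 d theta^2, i.e.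
  A = e^u, B = e^u f.\<close>
definition gA :: "(real \<Rightarrow> real \<Rightarrow> real) \<Rightarrow> real \<Rightarrow> real \<Rightarrow> real" where
  "gA u t = (\<lambda>r. exp (u r t))"

definition gB :: "(real \<Rightarrow> real) \<Rightarrow> (real \<Rightarrow> real \<Rightarrow> real) \<Rightarrow> real \<Rightarrow> real \<Rightarrow> real" where
  "gB f u t = (\<lambda>r. exp (u r t) * f r)"

definition flow_scal :: "(real \<Rightarrow> real) \<Rightarrow> (real \<Rightarrow> real \<Rightarrow> real) \<Rightarrow> real \<Rightarrow> real \<Rightarrow> real" where
  "flow_scal f u r t = rs_scal (gA u t) (gB f u t) r"

definition flow_total_scal :: "real \<Rightarrow> (real \<Rightarrow> real) \<Rightarrow> (real \<Rightarrow> real \<Rightarrow> real) \<Rightarrow> real \<Rightarrow> real" where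
  "flow_total_scal \<rho> f u t = rs_total_scal (gA u t) (gB f u t) \<rho>"

text \<open>g(t) = e^{2u(.,t)} g_0 is the (rotationally symmetric) normalised flow starting at g_0:
  d_t g = (r - R) g  (i.e. 2 d_t u = r - R),  k_g = k_{g_0} / sqrt phi  on the boundary,
  A_g(M) = 1, g(0) = g_0, where phi(0) = 1 and d_t (log phi) = r (this is the relation
  between phi and the new time t = int_0^{tilde t} phi).  Smooth for t > 0 up to the
  spatial boundary, continuous up to t = 0.\<close>
definition normalised_flow ::
  "real \<Rightarrow> (real \<Rightarrow> real) \<Rightarrow> (real \<Rightarrow> real \<Rightarrow> real) \<Rightarrow> (real \<Rightarrow> real) \<Rightarrow> bool" where
  "normalised_flow \<rho> f u \<phi> \<longleftrightarrow>
     (\<exists>U. open U \<and> {-\<rho>..\<rho>} \<times> {0<..} \<subseteq> U \<and> smooth2_on U u) \<and>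
     continuous_on ({-\<rho>..\<rho>} \<times> {0..}) (\<lambda>p. u (fst p) (snd p)) \<and>
     (\<forall>r\<in>{-\<rho>..\<rho>}. u r 0 = 0) \<and>
     continuous_on {0..} \<phi> \<and> \<phi> 0 = 1 \<and> (\<forall>t\<ge>0. \<phi> t > 0) \<and>
     (\<forall>t>0. (\<phi> has_real_derivative flow_total_scal \<rho> f u t * \<phi> t) (at t)) \<and>
     (\<forall>t>0. rs_area (gA u t) (gB f u t) \<rho> = 1) \<and>
     (\<forall>t>0. \<forall>r\<in>{-\<rho>..\<rho>}.
        2 * deriv (\<lambda>s. u r s) t = flow_total_scal \<rho> f u t - flow_scal f u r t) \<and>
     (\<forall>t>0. rs_geod_top (gA u t) (gB f u t) \<rho> = rs_geod_top (\<lambda>_. 1) f \<rho> / sqrt (\<phi> t)) \<and>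
     (\<forall>t>0. rs_geod_bot (gA u t) (gB f u t) \<rho> = rs_geod_bot (\<lambda>_. 1) f \<rho> / sqrt (\<phi> t))"

end

(* In the conformal coordinate s with ds = dr / f the metric is e^(2v) (ds^2 + dtheta^2), v = u + ln f.
   The flow gives R_t = Lap R + R (R - r), and differentiating the boundary condition in time gives
   R_nu = k R. As k <= 0, the minimum principle yields R >= -1/(t - 1) for t > 1, so v is almost concave;
   with unit area this bounds v at the two boundary circles. By Gauss-Bonnet r sqrt(phi) and hence
   (sqrt phi)' are then bounded above and, unless k = 0, bounded below by a positive constant, so r = O(1/t).
   For the energy E, the integral of R^2, one finds
   E' <= -2 D + (2 r^2 + 2 L D)(r + 2/(t - 1)), D the Dirichlet integral of R and L the conformal length,
   because (R - r)^2 <= L D. Since E >= 0, D has to become arbitrarily small at late times, and then so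
   does sup |R|. *)

theory Submission
  imports Defs
begin

text \<open>The estimates are uniform in time because the conformal structure is fixed: the
  coordinate s, the length \<open>L\<close> and the weight \<open>f\<close> of the Dirichlet
  integral never change, so \<open>L\<close> serves as a Sobolev constant for all times. The sign of
  k enters three times: it excludes negative boundary minima of R, it makes r nonnegative and hence
  phi monotone, and it gives the boundary term of the integration by parts a good sign. The obstacle
  is the integral of R^3 inside E', which has the wrong sign while no upper bound for R is
  available. One factor R is measured in L^1, where it is small because r is small and the negative
  part of R decays; the remaining R^2 is measured in the sup norm, at the price of D, and is
  absorbed by -2 D. Estimates start at time 1 because \<open>u\<close> is only continuous at time 0,
  which carries no curvature bound to later times; hence a barrier that starts at minus
  infinity.\<close>

section \<open>One-variable calculus on a closed interval\<close>

text \<open>At an endpoint a minimum forces only one sign of g'; \<open>top\<close> and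
  \<open>bot\<close> supply the other. So g' x = 0 in every case, and the one-sided second
  derivative test applies: q < 0 would give f g', hence g', a sign next to x that makes g drop below
  g x. The weight f is there because the test is applied to (f R_x)_x.\<close>

lemma second_derivative_nonneg_at_interval_min:
  fixes g g' f :: "real \<Rightarrow> real"
  assumes ab: "a < b" and x: "x \<in> {a..b}"
    and g: "\<And>y. y \<in> {a..b} \<Longrightarrow> (g has_real_derivative g' y) (at y within {a..b})"
    and f: "\<And>y. y \<in> {a..b} \<Longrightarrow> f y > 0"
    and q: "((\<lambda>y. f y * g' y) has_real_derivative q) (at x within {a..b})"
    and min: "\<And>y. y \<in> {a..b} \<Longrightarrow> g x \<le> g y"
    and top: "x = b \<Longrightarrow> 0 \<le> g' x" and bot: "x = a \<Longrightarrow> g' x \<le> 0"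
  shows "q \<ge> 0"
proof (rule ccontr)
  assume "\<not> q \<ge> 0"
  hence q0: "q < 0" by simp
  have ge: "g' x \<ge> 0" if "x < b"
  proof (rule ccontr)
    assume "\<not> g' x \<ge> 0"
    then obtain d where d: "d > 0" "\<And>h. h > 0 \<Longrightarrow> x + h \<in> {a..b} \<Longrightarrow> h < d \<Longrightarrow> g x > g (x + h)"
      using has_real_derivative_neg_dec_right[OF g[OF x]] by force
    have "g x > g (x + min (d/2) (b - x))" using d(1) that x by (intro d(2)) (auto simp: min_def)
    moreover have "g x \<le> g (x + min (d/2) (b - x))" using d(1) that x by (intro assms(6)) (auto simp: min_def)
    ultimately show False by simp
  qed
  have le: "g' x \<le> 0" if "a < x"
  proof (rule ccontr)
    assume "\<not> g' x \<le> 0"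
    then obtain d where d: "d > 0" "\<And>h. h > 0 \<Longrightarrow> x - h \<in> {a..b} \<Longrightarrow> h < d \<Longrightarrow> g (x - h) < g x"
      using has_real_derivative_pos_inc_left[OF g[OF x]] by force
    have "g x > g (x - min (d/2) (x - a))" using d(1) that x by (intro d(2)) (auto simp: min_def)
    moreover have "g x \<le> g (x - min (d/2) (x - a))" using d(1) that x by (intro assms(6)) (auto simp: min_def)
    ultimately show False by simp
  qed
  have g'0: "g' x = 0"
    using ge le top bot x ab by (cases "x = a"; cases "x = b") (auto intro: antisym)
  have mvt: "\<exists>w\<in>{y<..<z}. g z - g y = (z - y) * g' w" if "y < z" "a \<le> y" "z \<le> b" for y z
  proof (rule mvt_simple[OF that(1), of g "\<lambda>w h. h * g' w"])
    fix w assume w: "y \<le> w" "w \<le> z"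
    have "(g has_real_derivative g' w) (at w within {y..z})"
      using g[of w] w that by (intro has_field_derivative_subset[OF g]) auto
    thus "(g has_derivative (\<lambda>h. h * g' w)) (at w within {y..z})"
      by (simp add: has_field_derivative_def mult_commute_abs)
  qed
  show False
  proof (cases "x < b")
    case True
    obtain d where d: "d > 0" "\<And>h. h > 0 \<Longrightarrow> x + h \<in> {a..b} \<Longrightarrow> h < d \<Longrightarrow> f x * g' x > f (x + h) * g' (x + h)"
      using has_real_derivative_neg_dec_right[OF q q0] by force
    define y where "y = x + min (d/2) (b - x)"
    have y: "x < y" "y \<in> {a..b}" using d(1) True x by (auto simp: y_def min_def)
    obtain z where z: "z \<in> {x<..<y}" "g y - g x = (y - x) * g' z"
      using mvt[of x y] x y by auto
    have "f x * g' x > f (x + (z - x)) * g' (x + (z - x))"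
      using z y x d(1) by (intro d(2)) (auto simp: y_def min_def split: if_splits)
    hence "f z * g' z < 0" using g'0 by simp
    moreover have "f z > 0" using f z x y by simp
    ultimately have "g' z < 0" by (simp add: mult_less_0_iff)
    hence "g y < g x" using z y by (smt (verit) mult_pos_neg)
    thus False using min[OF y(2)] by simp
  next
    case False
    hence xb: "x = b" "a < x" using x ab by auto
    obtain d where d: "d > 0" "\<And>h. h > 0 \<Longrightarrow> x - h \<in> {a..b} \<Longrightarrow> h < d \<Longrightarrow> f x * g' x < f (x - h) * g' (x - h)"
      using has_real_derivative_neg_dec_left[OF q q0] by force
    define y where "y = x - min (d/2) (x - a)"
    have y: "y < x" "y \<in> {a..b}" using d(1) xb x by (auto simp: y_def min_def)
    obtain z where z: "z \<in> {y<..<x}" "g x - g y = (x - y) * g' z"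
      using mvt[of y x] x y by auto
    have "f x * g' x < f (x - (x - z)) * g' (x - (x - z))"
      using z y x d(1) by (intro d(2)) (auto simp: y_def min_def split: if_splits)
    hence "f z * g' z > 0" using g'0 by simp
    moreover have "f z > 0" using f z x y by simp
    ultimately have "g' z > 0" by (simp add: zero_less_mult_iff)
    hence "g y < g x" using z y by (smt (verit) mult_pos_pos)
    thus False using min[OF y(2)] by simp
  qed
qed

lemma has_integral_real_derivative:
  fixes g g' :: "real \<Rightarrow> real"
  assumes "\<And>z. z \<in> {a..b} \<Longrightarrow> (g has_real_derivative g' z) (at z within {a..b})"
    and "a \<le> x" "x \<le> y" "y \<le> b"
  shows "(g' has_integral g y - g x) {x..y}"
proof (rule fundamental_theorem_of_calculus)
  fix z assume "z \<in> {x..y}"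
  hence "(g has_real_derivative g' z) (at z within {x..y})"
    using assms by (intro has_field_derivative_subset[OF assms(1)]) auto
  thus "(g has_vector_derivative g' z) (at z within {x..y})"
    by (simp add: has_real_derivative_iff_has_vector_derivative)
qed fact

section \<open>The flow as a system of functions of position and time\<close>

text \<open>Spatial derivatives are one-sided at the ends, and all times are positive. That partial
  derivatives commute is built in: \<open>uxt\<close> is the x-derivative of \<open>ut\<close> and
  the t-derivative of \<open>ux\<close>, and likewise for \<open>uxxt\<close>. \<open>bdry\<close>
  is the condition on k_g multiplied by e^u f; the two ends share one form because the sign of the
  outward normal cancels.\<close>

locale cylinder_flow =
  fixes \<rho> :: real and f f1 f2 :: "real \<Rightarrow> real"
    and u ux uxx ut uxt uxxt :: "real \<Rightarrow> real \<Rightarrow> real"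
    and \<phi> r :: "real \<Rightarrow> real"
  assumes rho: "\<rho> > 0"
    and f_pos: "\<And>x. x \<in> {-\<rho>..\<rho>} \<Longrightarrow> f x > 0"
    and f_dx: "\<And>x. x \<in> {-\<rho>..\<rho>} \<Longrightarrow> (f has_real_derivative f1 x) (at x within {-\<rho>..\<rho>})"
    and f1_dx: "\<And>x. x \<in> {-\<rho>..\<rho>} \<Longrightarrow> (f1 has_real_derivative f2 x) (at x within {-\<rho>..\<rho>})"
    and f2_cont: "continuous_on {-\<rho>..\<rho>} f2"
    and f1_top: "f1 \<rho> \<le> 0" and f1_bot: "0 \<le> f1 (-\<rho>)"
    and u_dx: "\<And>x t. x \<in> {-\<rho>..\<rho>} \<Longrightarrow> 0 < t \<Longrightarrow>
      ((\<lambda>x. u x t) has_real_derivative ux x t) (at x within {-\<rho>..\<rho>})"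
    and ux_dx: "\<And>x t. x \<in> {-\<rho>..\<rho>} \<Longrightarrow> 0 < t \<Longrightarrow>
      ((\<lambda>x. ux x t) has_real_derivative uxx x t) (at x within {-\<rho>..\<rho>})"
    and ut_dx: "\<And>x t. x \<in> {-\<rho>..\<rho>} \<Longrightarrow> 0 < t \<Longrightarrow>
      ((\<lambda>x. ut x t) has_real_derivative uxt x t) (at x within {-\<rho>..\<rho>})"
    and uxt_dx: "\<And>x t. x \<in> {-\<rho>..\<rho>} \<Longrightarrow> 0 < t \<Longrightarrow>
      ((\<lambda>x. uxt x t) has_real_derivative uxxt x t) (at x within {-\<rho>..\<rho>})"
    and u_dt: "\<And>x t. x \<in> {-\<rho>..\<rho>} \<Longrightarrow> 0 < t \<Longrightarrow> (u x has_real_derivative ut x t) (at t)"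
    and ux_dt: "\<And>x t. x \<in> {-\<rho>..\<rho>} \<Longrightarrow> 0 < t \<Longrightarrow> (ux x has_real_derivative uxt x t) (at t)"
    and uxx_dt: "\<And>x t. x \<in> {-\<rho>..\<rho>} \<Longrightarrow> 0 < t \<Longrightarrow> (uxx x has_real_derivative uxxt x t) (at t)"
    and u_cont: "continuous_on ({-\<rho>..\<rho>} \<times> {0<..}) (\<lambda>p. u (fst p) (snd p))"
    and ux_cont: "continuous_on ({-\<rho>..\<rho>} \<times> {0<..}) (\<lambda>p. ux (fst p) (snd p))"
    and uxx_cont: "continuous_on ({-\<rho>..\<rho>} \<times> {0<..}) (\<lambda>p. uxx (fst p) (snd p))"
    and ut_cont: "continuous_on ({-\<rho>..\<rho>} \<times> {0<..}) (\<lambda>p. ut (fst p) (snd p))"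
    and uxt_cont: "continuous_on ({-\<rho>..\<rho>} \<times> {0<..}) (\<lambda>p. uxt (fst p) (snd p))"
    and uxxt_cont: "continuous_on ({-\<rho>..\<rho>} \<times> {0<..}) (\<lambda>p. uxxt (fst p) (snd p))"
    and phi_pos: "\<And>t. 0 < t \<Longrightarrow> \<phi> t > 0"
    and phi_dt: "\<And>t. 0 < t \<Longrightarrow> (\<phi> has_real_derivative r t * \<phi> t) (at t)"
    and area: "\<And>t. 0 < t \<Longrightarrow> 2 * pi * integral {-\<rho>..\<rho>} (\<lambda>x. exp (2 * u x t) * f x) = 1"
    and total_curvature: "\<And>t. 0 < t \<Longrightarrow>
      2 * pi * integral {-\<rho>..\<rho>} (\<lambda>x. - 2 * (f1 x * ux x t + f x * uxx x t + f2 x)) = r t"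
    and pde: "\<And>x t. x \<in> {-\<rho>..\<rho>} \<Longrightarrow> 0 < t \<Longrightarrow>
      2 * ut x t = r t + 2 * (f1 x * ux x t + f x * uxx x t + f2 x) / (exp (2 * u x t) * f x)"
    and bdry: "\<And>x t. x = \<rho> \<or> x = -\<rho> \<Longrightarrow> 0 < t \<Longrightarrow>
      f x * ux x t + f1 x = f1 x * exp (u x t) / sqrt (\<phi> t)"
begin

text \<open>\<open>m\<close> is the area density, and \<open>p\<close> is the derivative of \<open>v = u + ln f\<close> in the conformal coordinate.
  \<open>Rx\<close> and \<open>Q\<close> stand for \<open>R\<^sub>x\<close> and \<open>(f R\<^sub>x)\<^sub>x\<close>; taking them from \<open>R = r - 2 u\<^sub>t\<close> instead of the formula
  for \<open>R\<close> makes the evolution equation for \<open>m R\<close> immediate.\<close>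

definition m :: "real \<Rightarrow> real \<Rightarrow> real" where
  "m x t = exp (2 * u x t) * f x"

definition R :: "real \<Rightarrow> real \<Rightarrow> real" where
  "R x t = - 2 * (f1 x * ux x t + f x * uxx x t + f2 x) / m x t"

definition Rx :: "real \<Rightarrow> real \<Rightarrow> real" where
  "Rx x t = - 2 * uxt x t"

definition Q :: "real \<Rightarrow> real \<Rightarrow> real" where
  "Q x t = - 2 * (f1 x * uxt x t + f x * uxxt x t)"

definition p :: "real \<Rightarrow> real \<Rightarrow> real" where
  "p x t = f x * ux x t + f1 x"

section \<open>Regularity and evolution of the area density and the curvature\<close>

lemma m_pos: "x \<in> {-\<rho>..\<rho>} \<Longrightarrow> m x t > 0"
  by (simp add: m_def f_pos)

lemma f_cont: "continuous_on {-\<rho>..\<rho>} f"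
  using f_dx DERIV_continuous_on by blast

lemma f1_cont: "continuous_on {-\<rho>..\<rho>} f1"
  using f1_dx DERIV_continuous_on by blast

lemma lift_cont:
  "continuous_on {-\<rho>..\<rho>} h \<Longrightarrow> continuous_on ({-\<rho>..\<rho>} \<times> {0<..}) (\<lambda>p. h (fst p))"
  for h :: "real \<Rightarrow> real"
  by (rule continuous_on_compose2[of "{-\<rho>..\<rho>}" h]) (auto intro!: continuous_intros)

lemma slice_cont:
  "continuous_on ({-\<rho>..\<rho>} \<times> {0<..}) (\<lambda>p. g (fst p) (snd p)) \<Longrightarrow> 0 < t \<Longrightarrow>
   continuous_on {-\<rho>..\<rho>} (\<lambda>x. g x t)"
  for g :: "real \<Rightarrow> real \<Rightarrow> real"
  by (drule continuous_on_compose2[of "{-\<rho>..\<rho>} \<times> {0<..}" "\<lambda>p. g (fst p) (snd p)" "{-\<rho>..\<rho>}" "\<lambda>x. (x, t)"])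
    (auto intro!: continuous_intros)

lemmas f_conts = lift_cont[OF f_cont] lift_cont[OF f1_cont] lift_cont[OF f2_cont]
lemmas u_conts = u_cont ux_cont uxx_cont ut_cont uxt_cont uxxt_cont

lemma m_cont: "continuous_on ({-\<rho>..\<rho>} \<times> {0<..}) (\<lambda>p. m (fst p) (snd p))"
  unfolding m_def by (intro continuous_intros u_conts f_conts)

lemma R_cont: "continuous_on ({-\<rho>..\<rho>} \<times> {0<..}) (\<lambda>p. R (fst p) (snd p))"
  unfolding R_def by (intro continuous_intros u_conts f_conts m_cont) (auto simp: m_def dest: f_pos)

lemma Rx_cont: "continuous_on ({-\<rho>..\<rho>} \<times> {0<..}) (\<lambda>p. Rx (fst p) (snd p))"
  unfolding Rx_def by (intro continuous_intros u_conts)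

lemma Q_cont: "continuous_on ({-\<rho>..\<rho>} \<times> {0<..}) (\<lambda>p. Q (fst p) (snd p))"
  unfolding Q_def by (intro continuous_intros u_conts f_conts)

lemmas slice_conts = slice_cont[OF m_cont] slice_cont[OF R_cont] slice_cont[OF Rx_cont]
  slice_cont[OF Q_cont] f_cont

lemma m_R: "x \<in> {-\<rho>..\<rho>} \<Longrightarrow> m x t * R x t = - 2 * (f1 x * ux x t + f x * uxx x t + f2 x)"
  using m_pos[of x t] by (simp add: R_def)

lemma R_eq: "x \<in> {-\<rho>..\<rho>} \<Longrightarrow> 0 < t \<Longrightarrow> R x t = r t - 2 * ut x t"
proof -
  assume "x \<in> {-\<rho>..\<rho>}" "0 < t"
  moreover have "R x t = - (2 * (f1 x * ux x t + f x * uxx x t + f2 x) / (exp (2 * u x t) * f x))"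
    unfolding R_def m_def by (simp only: mult_minus_left minus_divide_left)
  ultimately show ?thesis using pde[of x t] by linarith
qed

lemma R_dx:
  assumes "x \<in> {-\<rho>..\<rho>}" "0 < t"
  shows "((\<lambda>x. R x t) has_real_derivative Rx x t) (at x within {-\<rho>..\<rho>})"
proof (rule has_field_derivative_transform_within[of "\<lambda>x. r t - 2 * ut x t" _ _ _ 1])
  show "((\<lambda>x. r t - 2 * ut x t) has_real_derivative Rx x t) (at x within {-\<rho>..\<rho>})"
    unfolding Rx_def using assms by (auto intro!: derivative_eq_intros ut_dx)
qed (use assms R_eq in auto)

lemma fRx_dx:
  assumes "x \<in> {-\<rho>..\<rho>}" "0 < t"
  shows "((\<lambda>x. f x * Rx x t) has_real_derivative Q x t) (at x within {-\<rho>..\<rho>})"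
  unfolding Rx_def Q_def using assms
  by (auto intro!: derivative_eq_intros f_dx uxt_dx simp: algebra_simps)

lemma p_dx:
  assumes "x \<in> {-\<rho>..\<rho>}" "0 < t"
  shows "((\<lambda>x. p x t) has_real_derivative - (m x t * R x t) / 2) (at x within {-\<rho>..\<rho>})"
  unfolding m_R[OF assms(1)] p_def using assms
  by (auto intro!: derivative_eq_intros f_dx f1_dx ux_dx simp: algebra_simps)

lemma m_dt:
  assumes "x \<in> {-\<rho>..\<rho>}" "0 < t"
  shows "((\<lambda>t. m x t) has_real_derivative (r t - R x t) * m x t) (at t)"
  unfolding R_eq[OF assms] m_def using assms
  by (auto intro!: derivative_eq_intros u_dt)

lemma mR_dt:
  assumes "x \<in> {-\<rho>..\<rho>}" "0 < t"
  shows "((\<lambda>t. m x t * R x t) has_real_derivative Q x t) (at t)"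
  unfolding m_R[OF assms(1)] Q_def using assms
  by (auto intro!: derivative_eq_intros ux_dt uxx_dt)

text \<open>\<open>Q x t / m x t\<close> is the Laplacian of R for g(t): for functions of x alone it
  is (f R_x)_x divided by the area density. The reaction term appears on dividing m R by m.\<close>

lemma R_dt:
  assumes "x \<in> {-\<rho>..\<rho>}" "0 < t"
  shows "((\<lambda>t. R x t) has_real_derivative Q x t / m x t + R x t * (R x t - r t)) (at t)"
proof -
  have "((\<lambda>t. m x t * R x t / m x t) has_real_derivative Q x t / m x t + R x t * (R x t - r t)) (at t)"
    using m_pos[OF assms(1), of t]
    by (intro DERIV_cong[OF DERIV_divide[OF mR_dt m_dt]] assms) (simp_all add: field_simps)
  moreover have "m x t * R x t / m x t = R x t" for t
    using m_pos[OF assms(1), of t] by simp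
  ultimately show ?thesis by simp
qed

section \<open>Boundary condition for R and the Gauss-Bonnet formula\<close>

text \<open>The right side of \<open>bdry\<close> has logarithmic time derivative u_t - r/2 = -R/2,
  and the left side has time derivative f u_xt = -f R_x / 2. The formula is R_nu = k R at both ends,
  since p and the outward normal switch their sign together.\<close>

lemma bdry_R:
  assumes x: "x = \<rho> \<or> x = -\<rho>" and t: "0 < t"
  shows "f x * Rx x t = p x t * R x t"
proof -
  have xI: "x \<in> {-\<rho>..\<rho>}" using x rho by auto
  have "((\<lambda>t. f1 x * exp (u x t) / sqrt (\<phi> t)) has_real_derivative
     f1 x * exp (u x t) / sqrt (\<phi> t) * (ut x t - r t / 2)) (at t)"
    using phi_pos[OF t]
    by (auto intro!: derivative_eq_intros u_dt phi_dt xI t simp: field_simps)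
  moreover have "((\<lambda>t. f1 x * exp (u x t) / sqrt (\<phi> t)) has_real_derivative f x * uxt x t) (at t)"
  proof (rule has_field_derivative_transform_within[of "\<lambda>t. f x * ux x t + f1 x" _ _ _ t])
    show "((\<lambda>t. f x * ux x t + f1 x) has_real_derivative f x * uxt x t) (at t)"
      by (auto intro!: derivative_eq_intros ux_dt xI t)
  qed (use t bdry[OF x] in \<open>auto simp: dist_real_def\<close>)
  ultimately have "f x * uxt x t = p x t * (ut x t - r t / 2)"
    unfolding p_def bdry[OF x t] by (rule DERIV_unique[symmetric])
  thus ?thesis unfolding Rx_def R_eq[OF xI t] by (simp add: algebra_simps)
qed

lemma p_top: "0 < t \<Longrightarrow> p \<rho> t \<le> 0"
  using bdry[of \<rho> t] phi_pos[of t] f1_top by (simp add: p_def divide_nonpos_pos mult_nonpos_nonneg)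

lemma p_bot: "0 < t \<Longrightarrow> p (-\<rho>) t \<ge> 0"
  using bdry[of "-\<rho>" t] phi_pos[of t] f1_bot by (simp add: p_def)

lemma int_m: "0 < t \<Longrightarrow> 2 * pi * integral {-\<rho>..\<rho>} (\<lambda>x. m x t) = 1"
  using area by (simp add: m_def)

lemma int_mR: "0 < t \<Longrightarrow> 2 * pi * integral {-\<rho>..\<rho>} (\<lambda>x. m x t * R x t) = r t"
  by (subst total_curvature[symmetric]) (simp_all only: m_R cong: integral_cong)

text \<open>Gauss-Bonnet on a surface of Euler characteristic 0: m R = -2 p_x, so the total
  curvature is a difference of boundary values of p.\<close>

lemma r_eq:
  assumes t: "0 < t"
  shows "r t = 4 * pi * (p (-\<rho>) t - p \<rho> t)"
proof -
  have "((\<lambda>x. - (m x t * R x t) / 2) has_integral p \<rho> t - p (-\<rho>) t) {-\<rho>..\<rho>}"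
    using rho t by (intro has_integral_real_derivative[OF p_dx]) auto
  hence "((\<lambda>x. m x t * R x t) has_integral (-2) * (p \<rho> t - p (-\<rho>) t)) {-\<rho>..\<rho>}"
    by (rule has_integral_eq_rhs[OF has_integral_eq[OF _ has_integral_mult_right[of _ _ _ "-2"]], rotated]) auto
  thus ?thesis using int_mR[OF t] by (simp add: integral_unique algebra_simps)
qed

lemma r_nonneg: "0 < t \<Longrightarrow> r t \<ge> 0"
  using r_eq[of t] p_top[of t] p_bot[of t] by simp

section \<open>Lower curvature bound by the minimum principle\<close>

text \<open>The barrier -1/(t-1) solves y' = y^2 and comes from minus infinity, so no bound at time
  1 is required. At a negative minimum of (t-1) R + 1 one has R < 0, so the term -r R helps because
  r is nonnegative; if the minimum lies on the boundary, f R_x = p R provides the sign of R_x that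
  the interval test asks for.\<close>

lemma R_ge:
  assumes x: "x \<in> {-\<rho>..\<rho>}" and t: "1 < t"
  shows "R x t \<ge> - 1 / (t - 1)"
proof (rule ccontr)
  assume "\<not> R x t \<ge> - 1 / (t - 1)"
  hence neg: "(t - 1) * R x t + 1 < 0" using t by (simp add: field_simps)
  define Z where "Z = (\<lambda>q. (snd q - 1) * R (fst q) (snd q) + 1)"
  have "continuous_on ({-\<rho>..\<rho>} \<times> {1..t}) Z"
    unfolding Z_def by (intro continuous_intros continuous_on_subset[OF R_cont]) auto
  then obtain q where q: "q \<in> {-\<rho>..\<rho>} \<times> {1..t}" "\<And>q'. q' \<in> {-\<rho>..\<rho>} \<times> {1..t} \<Longrightarrow> Z q \<le> Z q'"
    using continuous_attains_inf[of "{-\<rho>..\<rho>} \<times> {1..t}" Z] rho t x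
    by (metis atLeastAtMost_iff compact_Icc compact_Times empty_iff less_eq_real_def mem_Sigma_iff)
  obtain y s where ys: "q = (y, s)" by (cases q)
  have y: "y \<in> {-\<rho>..\<rho>}" and s: "1 \<le> s" "s \<le> t" using q(1) ys by auto
  have Zq: "(s - 1) * R y s + 1 < 0"
    using q(2)[of "(x, t)"] x t neg by (simp add: Z_def ys)
  hence s1: "1 < s" using s by (cases "s = 1") auto
  have Rneg: "R y s < 0" using Zq s1 by (smt (verit) mult_nonneg_nonneg)
  have min: "R y s \<le> R z s" if "z \<in> {-\<rho>..\<rho>}" for z
    using q(2)[of "(z, s)"] that s s1 by (simp add: Z_def ys)
  have Qpos: "Q y s \<ge> 0"
  proof (rule second_derivative_nonneg_at_interval_min[where g = "\<lambda>x. R x s" and g' = "\<lambda>x. Rx x s" and f = f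
        and a = "-\<rho>" and b = \<rho> and x = y])
    show "0 \<le> Rx y s" if "y = \<rho>"
    proof -
      have "f y * Rx y s \<ge> 0"
        using bdry_R[of y s] that s1 Rneg p_top[of s] by (simp add: mult_nonpos_nonpos)
      thus ?thesis using f_pos[OF y] by (simp add: zero_le_mult_iff)
    qed
    show "Rx y s \<le> 0" if "y = -\<rho>"
    proof -
      have "f y * Rx y s \<le> 0"
        using bdry_R[of y s] that s1 Rneg p_bot[of s] by (simp add: mult_nonneg_nonpos)
      thus ?thesis using f_pos[OF y] by (simp add: mult_le_0_iff)
    qed
  qed (use rho y min s1 R_dx f_pos fRx_dx in auto)
  define d where "d = R y s + (s - 1) * (Q y s / m y s + R y s * (R y s - r s))"
  have der: "((\<lambda>s. (s - 1) * R y s + 1) has_real_derivative d) (at s)"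
    unfolding d_def using y s1 by (auto intro!: derivative_eq_intros R_dt)
  \<comment> \<open>Sorted by sign: the first term is a product of two negative numbers and the
    others are nonnegative. So \<open>Z\<close> was strictly smaller just before time s, against the
    choice of the minimum.\<close>
  have "d = R y s * ((s - 1) * R y s + 1) + (s - 1) * (Q y s / m y s) + (s - 1) * (- R y s * r s)"
    unfolding d_def by (simp add: algebra_simps)
  moreover have "R y s * ((s - 1) * R y s + 1) > 0" using Rneg Zq by (rule mult_neg_neg)
  moreover have "(s - 1) * (Q y s / m y s) \<ge> 0" using s1 Qpos m_pos[OF y, of s] by simp
  moreover have "(s - 1) * (- R y s * r s) \<ge> 0"
    using s1 Rneg r_nonneg[of s] by (intro mult_nonneg_nonneg) auto
  ultimately have "d > 0" by linarith
  from DERIV_pos_inc_left[OF der this] obtain e where e: "e > 0"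
    "\<And>h. h > 0 \<Longrightarrow> h < e \<Longrightarrow> (s - h - 1) * R y (s - h) + 1 < (s - 1) * R y s + 1" by blast
  define h where "h = min (e/2) (s - 1)"
  have h: "h > 0" "h < e" "h \<le> s - 1" using e(1) s1 by (auto simp: h_def)
  have "(s - 1) * R y s + 1 \<le> (s - h - 1) * R y (s - h) + 1"
    using q(2)[of "(y, s - h)"] y s h by (simp add: Z_def ys)
  thus False using e(2)[OF h(1,2)] by simp
qed

section \<open>The conformal factor over the fixed flat cylinder, and what unit area says about
  it\<close>

definition v :: "real \<Rightarrow> real \<Rightarrow> real" where
  "v x t = u x t + ln (f x)"

definition L :: real where
  "L = integral {-\<rho>..\<rho>} (\<lambda>x. 1 / f x)"

lemma inv_f_cont: "continuous_on {-\<rho>..\<rho>} (\<lambda>x. 1 / f x)"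
  by (intro continuous_intros f_cont) (use f_pos in force)

lemma int_inv_f:
  assumes "-\<rho> \<le> x" "x \<le> y" "y \<le> \<rho>"
  shows "(\<lambda>x. 1 / f x) integrable_on {x..y}" "0 \<le> integral {x..y} (\<lambda>x. 1 / f x)"
    "integral {x..y} (\<lambda>x. 1 / f x) \<le> L"
proof -
  show int: "(\<lambda>x. 1 / f x) integrable_on {x..y}"
    using assms by (intro integrable_continuous_interval continuous_on_subset[OF inv_f_cont]) auto
  have pos: "z \<in> {-\<rho>..\<rho>} \<Longrightarrow> 0 \<le> 1 / f z" for z using f_pos[of z] by simp
  show "0 \<le> integral {x..y} (\<lambda>x. 1 / f x)"
    using assms pos by (intro integral_nonneg int) auto
  show "integral {x..y} (\<lambda>x. 1 / f x) \<le> L"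
    unfolding L_def using assms pos
    by (intro integral_subset_le int integrable_continuous_interval inv_f_cont) auto
qed

lemma L_pos: "0 < L"
proof -
  have "L \<noteq> 0"
  proof
    assume "L = 0"
    moreover have "0 \<le> 1 / f x" if "x \<in> {-\<rho>..\<rho>}" for x using f_pos[OF that] by simp
    ultimately have "\<forall>x\<in>{-\<rho>..\<rho>}. 1 / f x = 0"
      using integral_eq_0_iff[OF inv_f_cont] rho by (simp add: L_def)
    thus False using f_pos[of 0] rho by simp
  qed
  moreover have "0 \<le> L" using int_inv_f(2)[of "-\<rho>" \<rho>] rho by (simp add: L_def)
  ultimately show ?thesis by simp
qed

lemma v_dx:
  assumes "x \<in> {-\<rho>..\<rho>}" "0 < t"
  shows "((\<lambda>x. v x t) has_real_derivative p x t / f x) (at x within {-\<rho>..\<rho>})"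
  unfolding v_def p_def using assms f_pos[OF assms(1)]
  by (auto intro!: derivative_eq_intros u_dx f_dx simp: field_simps)

lemma v_diff:
  assumes "-\<rho> \<le> x" "x \<le> y" "y \<le> \<rho>" "0 < t"
  shows "((\<lambda>x. p x t / f x) has_integral v y t - v x t) {x..y}"
  by (rule has_integral_real_derivative[OF v_dx[OF _ assms(4)] assms(1-3)])

lemma v_diff_le:
  assumes xy: "-\<rho> \<le> x" "x \<le> y" "y \<le> \<rho>" "0 < t" and c: "0 \<le> c"
    and p: "\<And>z. z \<in> {x..y} \<Longrightarrow> p z t \<le> c"
  shows "v y t - v x t \<le> c * L"
proof -
  have "v y t - v x t \<le> c * integral {x..y} (\<lambda>x. 1 / f x)"
  proof (rule has_integral_le[OF v_diff[OF xy]])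
    show "((\<lambda>x. c * (1 / f x)) has_integral c * integral {x..y} (\<lambda>x. 1 / f x)) {x..y}"
      using int_inv_f(1)[OF xy(1-3)] by (intro has_integral_mult_right integrable_integral)
    show "p z t / f z \<le> c * (1 / f z)" if "z \<in> {x..y}" for z
      using p[OF that] f_pos[of z] that xy by (simp add: divide_right_mono)
  qed
  also have "\<dots> \<le> c * L" using int_inv_f(3)[OF xy(1-3)] c by (rule mult_left_mono)
  finally show ?thesis .
qed

lemma v_diff_ge:
  assumes xy: "-\<rho> \<le> x" "x \<le> y" "y \<le> \<rho>" "0 < t" and c: "0 \<le> c"
    and p: "\<And>z. z \<in> {x..y} \<Longrightarrow> - c \<le> p z t"
  shows "- (c * L) \<le> v y t - v x t"
proof -
  have "(- c) * L \<le> (- c) * integral {x..y} (\<lambda>x. 1 / f x)"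
    using int_inv_f(3)[OF xy(1-3)] c by (intro mult_left_mono_neg) auto
  also have "\<dots> \<le> v y t - v x t"
  proof (rule has_integral_le[OF _ v_diff[OF xy]])
    show "((\<lambda>x. (- c) * (1 / f x)) has_integral (- c) * integral {x..y} (\<lambda>x. 1 / f x)) {x..y}"
      using int_inv_f(1)[OF xy(1-3)] by (intro has_integral_mult_right integrable_integral)
    show "(- c) * (1 / f z) \<le> p z t / f z" if "z \<in> {x..y}" for z
      using p[OF that] f_pos[of z] that xy divide_right_mono[of "- c" "p z t" "f z"] by simp
  qed
  finally show ?thesis by simp
qed

lemma m_eq_v: "x \<in> {-\<rho>..\<rho>} \<Longrightarrow> m x t = exp (2 * v x t) * (1 / f x)"
  using f_pos[of x] by (simp add: m_def v_def exp_add distrib_left exp_double power2_eq_square)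

text \<open>The constant value of v for which the flat cylinder of length \<open>L\<close> has area
  one. As the area of g(t) is one, v can lie neither entirely below nor entirely above it.\<close>

definition B :: real where
  "B = ln (1 / (2 * pi * L)) / 2"

lemma exp_B: "exp (2 * B) * L = 1 / (2 * pi)"
  using L_pos by (simp add: B_def)

lemma m_integrable: "0 < t \<Longrightarrow> (\<lambda>x. m x t) integrable_on {-\<rho>..\<rho>}"
  by (intro integrable_continuous_interval slice_conts)

lemma int_m': "0 < t \<Longrightarrow> integral {-\<rho>..\<rho>} (\<lambda>x. m x t) = 1 / (2 * pi)"
  using int_m[of t] by (simp add: field_simps)

lemma B_le:
  assumes t: "0 < t" and b: "\<And>x. x \<in> {-\<rho>..\<rho>} \<Longrightarrow> v x t \<le> b"
  shows "B \<le> b"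
proof -
  have "integral {-\<rho>..\<rho>} (\<lambda>x. m x t) \<le> integral {-\<rho>..\<rho>} (\<lambda>x. exp (2 * b) * (1 / f x))"
  proof (rule integral_le)
    show "m x t \<le> exp (2 * b) * (1 / f x)" if "x \<in> {-\<rho>..\<rho>}" for x
      unfolding m_eq_v[OF that] using b[OF that] f_pos[OF that] by (intro mult_right_mono) auto
  qed (intro m_integrable[OF t] integrable_continuous_interval continuous_on_mult_left[OF inv_f_cont])+
  hence "exp (2 * B) * L \<le> exp (2 * b) * L"
    unfolding exp_B int_m'[OF t] by (simp only: L_def integral_mult_right)
  thus ?thesis using L_pos by simp
qed

lemma B_ge:
  assumes t: "0 < t" and b: "\<And>x. x \<in> {-\<rho>..\<rho>} \<Longrightarrow> b \<le> v x t"
  shows "b \<le> B"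
proof -
  have "integral {-\<rho>..\<rho>} (\<lambda>x. exp (2 * b) * (1 / f x)) \<le> integral {-\<rho>..\<rho>} (\<lambda>x. m x t)"
  proof (rule integral_le)
    show "exp (2 * b) * (1 / f x) \<le> m x t" if "x \<in> {-\<rho>..\<rho>}" for x
      unfolding m_eq_v[OF that] using b[OF that] f_pos[OF that] by (intro mult_right_mono) auto
  qed (intro m_integrable[OF t] integrable_continuous_interval continuous_on_mult_left[OF inv_f_cont])+
  hence "exp (2 * b) * L \<le> exp (2 * B) * L"
    unfolding exp_B int_m'[OF t] by (simp only: L_def integral_mult_right)
  thus ?thesis using L_pos by simp
qed

text \<open>p_x = -m R / 2, and R is at least -1 from time 2 on, so p_x is at most m. The integral
  of m is 1 / (2 pi), which the constant 1 generously covers.\<close>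

lemma p_almost_decreasing:
  assumes xy: "-\<rho> \<le> x" "x \<le> y" "y \<le> \<rho>" and t: "2 \<le> t"
  shows "p y t \<le> p x t + 1"
proof -
  have "p y t - p x t \<le> integral {x..y} (\<lambda>x. m x t)"
  proof (rule has_integral_le)
    show "((\<lambda>x. - (m x t * R x t) / 2) has_integral p y t - p x t) {x..y}"
      using t by (intro has_integral_real_derivative[OF p_dx xy]) auto
    show "((\<lambda>x. m x t) has_integral integral {x..y} (\<lambda>x. m x t)) {x..y}"
      using assms by (intro integrable_integral integrable_continuous_interval
          continuous_on_subset[OF slice_cont[OF m_cont]]) auto
    show "- (m z t * R z t) / 2 \<le> m z t" if "z \<in> {x..y}" for z
    proof -
      have z: "z \<in> {-\<rho>..\<rho>}" using that xy by auto
      have "- 1 \<le> - 1 / (t - 1)" using t by (simp add: field_simps)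
      hence "- 1 \<le> R z t" using R_ge[OF z, of t] t by linarith
      hence "m z t * (- 2) \<le> m z t * R z t"
        using m_pos[OF z, of t] by (intro mult_left_mono) auto
      thus ?thesis by simp
    qed
  qed
  also have "\<dots> \<le> integral {-\<rho>..\<rho>} (\<lambda>x. m x t)"
    using xy t m_pos
    by (intro integral_subset_le m_integrable integrable_continuous_interval
        continuous_on_subset[OF slice_cont[OF m_cont]]) (auto intro: less_imp_le)
  also have "\<dots> \<le> 1"
    using int_m[of t] t pi_gt3 by (simp add: field_simps) (smt (verit) mult_less_cancel_right2)
  finally show ?thesis by simp
qed

section \<open>Boundary values of v and decay of the average curvature\<close>

lemma phi_mono:
  assumes "1 \<le> s" "s \<le> t"
  shows "\<phi> s \<le> \<phi> t"
proof (rule DERIV_nonneg_imp_nondecreasing[OF assms(2)])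
  fix x assume "s \<le> x"
  hence "0 < x" using assms by simp
  thus "\<exists>y. (\<phi> has_real_derivative y) (at x) \<and> 0 \<le> y"
    using phi_dt phi_pos r_nonneg by (meson mult_nonneg_nonneg less_imp_le)
qed

text \<open>\<open>- kb\<close> and \<open>- kt\<close> are the geodesic curvatures of the boundary circles at time 0.\<close>

definition kb :: real where "kb = f1 (-\<rho>) / f (-\<rho>)"
definition kt :: real where "kt = - f1 \<rho> / f \<rho>"

lemma kb_nonneg: "0 \<le> kb" and kt_nonneg: "0 \<le> kt"
  using f1_top f1_bot f_pos[of \<rho>] f_pos[of "-\<rho>"] rho by (auto simp: kb_def kt_def divide_nonpos_pos)

lemma p_bot_eq: "0 < t \<Longrightarrow> p (-\<rho>) t = kb * exp (v (-\<rho>) t) / sqrt (\<phi> t)"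
  using bdry[of "-\<rho>" t] f_pos[of "-\<rho>"] rho
  by (simp add: p_def kb_def v_def exp_add)

lemma p_top_eq: "0 < t \<Longrightarrow> p \<rho> t = - (kt * exp (v \<rho> t) / sqrt (\<phi> t))"
  using bdry[of \<rho> t] f_pos[of \<rho>] rho
  by (simp add: p_def kt_def v_def exp_add)

text \<open>A bound independent of time: as phi is nondecreasing from time 1 on, \<open>k\<close>
  dominates \<open>kb / sqrt (\<phi> t)\<close> and \<open>kt / sqrt (\<phi> t)\<close> for all t >=
  1.\<close>

definition k where "k = (kb + kt) / sqrt (\<phi> 1)"

lemma k_nonneg: "0 \<le> k"
  using kb_nonneg kt_nonneg phi_pos[of 1] by (simp add: k_def)

text \<open>In the conformal coordinate v has slope p. At the ends p is expressed through v itself,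
  and almost monotonicity carries this to the interior with an error 1, so integration over a length
  at most \<open>L\<close> gives the upper bounds. For the lower bound, if p is nonnegative at x
  then p >= -1 to the left of x; if it is negative then p <= 1 to the right. Either way one end lies
  at most \<open>L\<close> above v at x.\<close>

lemma v_bounds:
  assumes t: "2 \<le> t" and x: "x \<in> {-\<rho>..\<rho>}"
  shows v_le_bot: "v x t \<le> v (-\<rho>) t + (k * exp (v (-\<rho>) t) + 1) * L"
    and v_le_top: "v x t \<le> v \<rho> t + (k * exp (v \<rho> t) + 1) * L"
    and v_ge_min: "min (v (-\<rho>) t) (v \<rho> t) - L \<le> v x t"
proof -
  have sq: "0 < sqrt (\<phi> 1)" "sqrt (\<phi> 1) \<le> sqrt (\<phi> t)" using phi_mono[of 1 t] phi_pos[of 1] t by auto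
  have kk: "kb / sqrt (\<phi> t) \<le> k" "kt / sqrt (\<phi> t) \<le> k"
    unfolding k_def using sq kb_nonneg kt_nonneg by (auto intro!: frac_le)
  have pb: "p (-\<rho>) t \<le> k * exp (v (-\<rho>) t)"
    using mult_right_mono[OF kk(1), of "exp (v (-\<rho>) t)"] t by (simp add: p_bot_eq)
  have pt: "- p \<rho> t \<le> k * exp (v \<rho> t)"
    using mult_right_mono[OF kk(2), of "exp (v \<rho> t)"] t by (simp add: p_top_eq)
  have up: "p z t \<le> k * exp (v (-\<rho>) t) + 1" if "z \<in> {-\<rho>..\<rho>}" for z
    using p_almost_decreasing[of "-\<rho>" z t] that t pb by auto
  have lo: "- (k * exp (v \<rho> t) + 1) \<le> p z t" if "z \<in> {-\<rho>..\<rho>}" for z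
    using p_almost_decreasing[of z \<rho> t] that t pt by auto
  show "v x t \<le> v (-\<rho>) t + (k * exp (v (-\<rho>) t) + 1) * L"
    using v_diff_le[of "-\<rho>" x t "k * exp (v (-\<rho>) t) + 1"] x t up k_nonneg by (auto simp: algebra_simps)
  show "v x t \<le> v \<rho> t + (k * exp (v \<rho> t) + 1) * L"
    using v_diff_ge[of x \<rho> t "k * exp (v \<rho> t) + 1"] x t lo k_nonneg by (auto simp: algebra_simps)
  show "min (v (-\<rho>) t) (v \<rho> t) - L \<le> v x t"
  proof (cases "p x t \<ge> 0")
    case True
    have "- (1 * L) \<le> v x t - v (-\<rho>) t"
      using p_almost_decreasing[of _ x t] x t True by (intro v_diff_ge) force+
    thus ?thesis by (auto simp: min_def)
  next
    case False
    have "v \<rho> t - v x t \<le> 1 * L"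
      using p_almost_decreasing[of x _ t] x t False by (intro v_diff_le) force+
    thus ?thesis by (auto simp: min_def)
  qed
qed

definition Mv where "Mv = B + L + (k * exp (B + L) + 1) * L"
definition Nv where "Nv = min 0 (B - (k + 1) * L)"

text \<open>The lower of the two ends is at most B + L, for otherwise v would exceed
  \<open>B\<close> everywhere. The upper bound for v in terms of that end increases with its value,
  and \<open>Mv\<close> is what it yields at B + L.\<close>

lemma v_end_le:
  assumes t: "2 \<le> t" and x: "x = \<rho> \<or> x = -\<rho>"
  shows "v x t \<le> Mv"
proof -
  have xI: "x \<in> {-\<rho>..\<rho>}" using x rho by auto
  have "min (v (-\<rho>) t) (v \<rho> t) - L \<le> B"
    using t by (intro B_ge[of t] v_ge_min) auto
  hence "v (-\<rho>) t \<le> B + L \<or> v \<rho> t \<le> B + L" by linarith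
  moreover have Mv: "w + (k * exp w + 1) * L \<le> Mv" if "w \<le> B + L" for w
    unfolding Mv_def using that k_nonneg L_pos by (intro add_mono mult_right_mono mult_left_mono) auto
  ultimately show ?thesis
    using order.trans[OF v_le_bot[OF t xI] Mv] order.trans[OF v_le_top[OF t xI] Mv] by blast
qed

text \<open>If v <= 0 at this end, then e^v <= 1 there, so the upper bound for v from this end is at
  most v + (k + 1) L, and unit area forces it to reach \<open>B\<close>. The minimum with 0 in
  \<open>Nv\<close> covers the other case.\<close>

lemma v_end_ge:
  assumes t: "2 \<le> t" and x: "x = \<rho> \<or> x = -\<rho>"
  shows "Nv \<le> v x t"
proof (cases "v x t \<le> 0")
  case True
  have "B \<le> v x t + (k * exp (v x t) + 1) * L"
    using t x v_le_bot v_le_top by (intro B_le[of t]) auto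
  also have "\<dots> \<le> v x t + (k + 1) * L"
    using k_nonneg L_pos True by (intro add_mono mult_right_mono mult_left_le) auto
  finally show ?thesis by (simp add: Nv_def)
qed (simp add: Nv_def)

lemma r_sqrt_phi: "0 < t \<Longrightarrow> r t * sqrt (\<phi> t) = 4 * pi * (kb * exp (v (-\<rho>) t) + kt * exp (v \<rho> t))"
  using phi_pos[of t] by (simp add: r_eq p_bot_eq p_top_eq distrib_right flip: add_divide_distrib)

text \<open>The derivative of sqrt phi is r sqrt phi / 2, so a lower bound for r sqrt phi makes sqrt
  phi grow linearly from time 2. Dividing the upper bound for r sqrt phi by this growth cancels kb +
  kt and leaves the stated constant. If kb + kt = 0 there is no growth, but then r = 0.\<close>

lemma r_decay:
  assumes t: "2 < t"
  shows "r t \<le> 2 * exp (Mv - Nv) / (t - 2)"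
proof (cases "kb + kt = 0")
  case True
  hence "kb = 0" "kt = 0" using kb_nonneg kt_nonneg by linarith+
  hence "r t = 0" using t r_eq[of t] by (simp add: p_bot_eq p_top_eq)
  thus ?thesis using t by simp
next
  case False
  hence kpos: "0 < kb + kt" using kb_nonneg kt_nonneg by linarith
  define h where "h s = sqrt (\<phi> s) - 2 * pi * ((kb + kt) * exp Nv) * s" for s
  have "h 2 \<le> h t"
  proof (rule DERIV_nonneg_imp_nondecreasing[OF less_imp_le[OF t]])
    fix s assume s: "2 \<le> s" "s \<le> t"
    have "(kb + kt) * exp Nv \<le> kb * exp (v (-\<rho>) s) + kt * exp (v \<rho> s)"
      unfolding distrib_right using s v_end_ge kb_nonneg kt_nonneg
      by (intro add_mono mult_left_mono) auto
    hence "2 * pi * ((kb + kt) * exp Nv) \<le> r s * sqrt (\<phi> s) / 2"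
      using r_sqrt_phi[of s] s by simp
    moreover have "(h has_real_derivative
       r s * sqrt (\<phi> s) / 2 - 2 * pi * ((kb + kt) * exp Nv)) (at s)"
      unfolding h_def using s phi_pos[of s]
      by (auto intro!: derivative_eq_intros phi_dt simp: field_simps)
    ultimately show "\<exists>y. (h has_real_derivative y) (at s) \<and> 0 \<le> y"
      by force
  qed
  hence sq: "2 * pi * ((kb + kt) * exp Nv) * (t - 2) \<le> sqrt (\<phi> t)"
    using real_sqrt_gt_zero[OF phi_pos[of 2]] unfolding h_def right_diff_distrib by linarith
  have "(2 * pi * (kb + kt)) * (r t * exp Nv * (t - 2)) = r t * (2 * pi * ((kb + kt) * exp Nv) * (t - 2))"
    by (simp only: mult_ac)
  also have "\<dots> \<le> r t * sqrt (\<phi> t)"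
    using sq r_nonneg[of t] t by (intro mult_left_mono) auto
  also have "\<dots> \<le> 4 * pi * ((kb + kt) * exp Mv)"
    unfolding r_sqrt_phi[OF order.strict_trans[OF zero_less_numeral t]] distrib_right
    using t v_end_le kb_nonneg kt_nonneg
    by (intro add_mono mult_left_mono) auto
  also have "\<dots> = (2 * pi * (kb + kt)) * (2 * exp Mv)" by simp
  finally have "r t * exp Nv * (t - 2) \<le> 2 * exp Mv"
    using kpos by (subst (asm) mult_le_cancel_left_pos) auto
  thus ?thesis using t by (simp add: exp_diff field_simps)
qed

section \<open>The energy inequality\<close>

definition E :: "real \<Rightarrow> real" where
  "E t = integral {-\<rho>..\<rho>} (\<lambda>x. m x t * (R x t)\<^sup>2)"

text \<open>The conformal factor cancels in |grad R|^2 dA, so the weight is \<open>f\<close> and not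
  \<open>m\<close>. The factor 2 pi from the circle is left out here, as in
  \<open>E\<close>.\<close>

definition D :: "real \<Rightarrow> real" where
  "D t = integral {-\<rho>..\<rho>} (\<lambda>x. f x * (Rx x t)\<^sup>2)"

lemma D_nonneg: "0 < t \<Longrightarrow> 0 \<le> D t"
  unfolding D_def
  by (intro integral_nonneg integrable_continuous_interval continuous_intros slice_conts)
    (auto intro!: mult_nonneg_nonneg less_imp_le[OF f_pos])

lemma E_nonneg: "0 < t \<Longrightarrow> 0 \<le> E t"
  unfolding E_def
  by (intro integral_nonneg integrable_continuous_interval continuous_intros slice_conts)
    (auto intro!: mult_nonneg_nonneg less_imp_le[OF m_pos])

lemma E_dt:
  assumes t: "0 < t"
  shows "(E has_real_derivative
    integral {-\<rho>..\<rho>} (\<lambda>x. 2 * R x t * Q x t - (r t - R x t) * m x t * (R x t)\<^sup>2)) (at t)"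
proof -
  \<comment> \<open>The derivative is written with \<open>2 * ut\<close> in place of
    \<open>r - R\<close>: the Leibniz rule asks for joint continuity, which the locale supplies for
    \<open>ut\<close> but does not assume for \<open>r\<close>. Splitting m R^2 as (m R) R lets the
    simple derivative of m R be used.\<close>
  have der: "((\<lambda>t. m x t * (R x t)\<^sup>2) has_real_derivative
     2 * R x s * Q x s - 2 * ut x s * m x s * (R x s)\<^sup>2) (at s)"
    if x: "x \<in> {-\<rho>..\<rho>}" and s: "0 < s" for x s
  proof -
    have "((\<lambda>t. (m x t * R x t) * R x t) has_real_derivative
      Q x s * R x s + (Q x s / m x s + R x s * (R x s - r s)) * (m x s * R x s)) (at s)"
      by (intro derivative_intros mR_dt R_dt x s)
    moreover have "Q x s * R x s + (Q x s / m x s + R x s * (R x s - r s)) * (m x s * R x s) =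
      2 * R x s * Q x s - 2 * ut x s * m x s * (R x s)\<^sup>2"
    proof -
      have "r s = R x s + 2 * ut x s" using R_eq[OF x s] by simp
      thus ?thesis using m_pos[OF x, of s] by (simp add: field_simps power2_eq_square)
    qed
    ultimately show ?thesis by (simp add: power2_eq_square mult.assoc)
  qed
  have swap: "continuous_on ({0<..} \<times> {-\<rho>..\<rho>}) (\<lambda>(s, x). g x s)"
    if "continuous_on ({-\<rho>..\<rho>} \<times> {0<..}) (\<lambda>p. g (fst p) (snd p))" for g :: "real \<Rightarrow> real \<Rightarrow> real"
  proof -
    have "continuous_on ({0<..} \<times> {-\<rho>..\<rho>}) (\<lambda>q. g (fst (prod.swap q)) (snd (prod.swap q)))"
      by (rule continuous_on_compose2[OF that continuous_on_swap]) auto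
    thus ?thesis by (simp add: case_prod_unfold)
  qed
  define g where "g t x = m x t * (R x t)\<^sup>2" for t x
  define g' where "g' s x = 2 * R x s * Q x s - 2 * ut x s * m x s * (R x s)\<^sup>2" for s x
  have "((\<lambda>t. integral (cbox (-\<rho>) \<rho>) (g t)) has_real_derivative integral (cbox (-\<rho>) \<rho>) (g' t))
    (at t within {0<..})"
  proof (rule leibniz_rule_field_derivative)
    show "((\<lambda>s. g s x) has_real_derivative g' s x) (at s within {0<..})"
      if "s \<in> {0<..}" "x \<in> cbox (-\<rho>) \<rho>" for s x
    proof (rule has_field_derivative_at_within)
      show "((\<lambda>s. g s x) has_real_derivative g' s x) (at s)"
        unfolding g_def g'_def by (rule der) (use that in simp_all)
    qed
    show "continuous_on ({0<..} \<times> cbox (-\<rho>) \<rho>) (\<lambda>(s, x). g' s x)"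
      unfolding cbox_interval g'_def
      by (rule swap) (intro continuous_intros R_cont Q_cont ut_cont m_cont)
    show "g s integrable_on cbox (-\<rho>) \<rho>" if "s \<in> {0<..}" for s
      unfolding cbox_interval g_def using that
      by (intro integrable_continuous_interval continuous_intros slice_conts) auto
    show "t \<in> {0<..}" using t by simp
  qed simp
  hence "(E has_real_derivative integral {-\<rho>..\<rho>} (g' t)) (at t)"
    using t unfolding E_def[abs_def] g_def cbox_interval by (simp add: at_within_open[OF _ open_greaterThan])
  moreover have "integral {-\<rho>..\<rho>} (g' t) =
      integral {-\<rho>..\<rho>} (\<lambda>x. 2 * R x t * Q x t - (r t - R x t) * m x t * (R x t)\<^sup>2)"
    unfolding g'_def by (intro integral_cong) (simp add: R_eq t)
  ultimately show ?thesis by simp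
qed

text \<open>Integration by parts. By the boundary condition R f R_x = p R^2 at the ends, and the
  signs of p there make the boundary contribution nonpositive.\<close>

lemma int_RQ:
  assumes t: "0 < t"
  shows "integral {-\<rho>..\<rho>} (\<lambda>x. R x t * Q x t) \<le> - D t"
proof -
  have "((\<lambda>x. Rx x t * (f x * Rx x t) + R x t * Q x t) has_integral
      R \<rho> t * (f \<rho> * Rx \<rho> t) - R (-\<rho>) t * (f (-\<rho>) * Rx (-\<rho>) t)) {-\<rho>..\<rho>}"
  proof (rule fundamental_theorem_of_calculus)
    show "((\<lambda>x. R x t * (f x * Rx x t)) has_vector_derivative
       Rx x t * (f x * Rx x t) + R x t * Q x t) (at x within {-\<rho>..\<rho>})" if "x \<in> {-\<rho>..\<rho>}" for x
      unfolding has_real_derivative_iff_has_vector_derivative[symmetric]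
      using DERIV_mult[OF R_dx[OF that t] fRx_dx[OF that t]] by (simp add: mult.commute add.commute)
  qed (use rho in auto)
  also have "R \<rho> t * (f \<rho> * Rx \<rho> t) - R (-\<rho>) t * (f (-\<rho>) * Rx (-\<rho>) t) =
      p \<rho> t * (R \<rho> t)\<^sup>2 - p (-\<rho>) t * (R (-\<rho>) t)\<^sup>2"
    using bdry_R[of \<rho> t] bdry_R[of "-\<rho>" t] t by (simp add: power2_eq_square)
  finally have "integral {-\<rho>..\<rho>} (\<lambda>x. f x * (Rx x t)\<^sup>2 + R x t * Q x t) =
      p \<rho> t * (R \<rho> t)\<^sup>2 - p (-\<rho>) t * (R (-\<rho>) t)\<^sup>2"
    by (intro integral_unique) (simp add: power2_eq_square mult_ac)
  also have "\<dots> \<le> 0"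
    using p_top[OF t] p_bot[OF t] mult_nonpos_nonneg[of "p \<rho> t" "(R \<rho> t)\<^sup>2"]
      mult_nonneg_nonneg[of "p (-\<rho>) t" "(R (-\<rho>) t)\<^sup>2"] zero_le_power2[of "R \<rho> t"]
      zero_le_power2[of "R (-\<rho>) t"] by linarith
  finally show ?thesis
    unfolding D_def using t
    by (subst (asm) integral_add) (auto intro!: integrable_continuous_interval continuous_intros slice_conts)
qed

text \<open>Cauchy-Schwarz for R_x = (sqrt f R_x) (1 / sqrt f), with both integrals then enlarged to
  the whole interval.\<close>

lemma R_osc_le:
  assumes xy: "-\<rho> \<le> x" "x \<le> y" "y \<le> \<rho>" and t: "0 < t"
  shows "(R y t - R x t)\<^sup>2 \<le> L * D t"
proof -
  define d where "d = R y t - R x t"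
  \<comment> \<open>This c minimises D - 2 c d + c^2 L, the bound obtained by integrating the square
    f (R_x - c / f)^2.\<close>
  define c where "c = d / L"
  have sub: "{x..y} \<subseteq> {-\<rho>..\<rho>}" using xy by auto
  have cont: "continuous_on {-\<rho>..\<rho>} (\<lambda>z. f z * (Rx z t)\<^sup>2)"
    using t by (intro continuous_intros slice_conts)
  have int1: "(\<lambda>z. f z * (Rx z t)\<^sup>2) integrable_on {x..y}"
    by (intro integrable_continuous_interval continuous_on_subset[OF cont sub])
  have int2: "((\<lambda>z. Rx z t) has_integral d) {x..y}"
    unfolding d_def by (rule has_integral_real_derivative[OF R_dx[OF _ t] xy])
  have "((\<lambda>z. f z * (Rx z t)\<^sup>2 - 2 * c * Rx z t + c\<^sup>2 * (1 / f z)) has_integral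
      integral {x..y} (\<lambda>z. f z * (Rx z t)\<^sup>2) - 2 * c * d + c\<^sup>2 * integral {x..y} (\<lambda>z. 1 / f z)) {x..y}"
    by (intro has_integral_add has_integral_diff has_integral_mult_right int2
        integrable_integral int1 int_inv_f(1)[OF xy])
  hence "0 \<le> integral {x..y} (\<lambda>z. f z * (Rx z t)\<^sup>2) - 2 * c * d + c\<^sup>2 * integral {x..y} (\<lambda>z. 1 / f z)"
  proof (rule has_integral_nonneg)
    fix z assume "z \<in> {x..y}"
    hence fz: "f z > 0" using f_pos sub by blast
    hence "f z * (Rx z t)\<^sup>2 - 2 * c * Rx z t + c\<^sup>2 * (1 / f z) = f z * (Rx z t - c / f z)\<^sup>2"
      by (simp add: power2_eq_square field_simps)
    thus "0 \<le> f z * (Rx z t)\<^sup>2 - 2 * c * Rx z t + c\<^sup>2 * (1 / f z)" using fz by simp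
  qed
  moreover have "integral {x..y} (\<lambda>z. f z * (Rx z t)\<^sup>2) \<le> D t"
    unfolding D_def
    by (intro integral_subset_le sub int1 integrable_continuous_interval cont)
      (auto intro!: mult_nonneg_nonneg less_imp_le[OF f_pos])
  moreover have "c\<^sup>2 * integral {x..y} (\<lambda>z. 1 / f z) \<le> c\<^sup>2 * L"
    by (intro mult_left_mono int_inv_f(3)[OF xy]) auto
  ultimately have "0 \<le> D t - 2 * c * d + c\<^sup>2 * L" by linarith
  also have "\<dots> = D t - d\<^sup>2 / L" using L_pos by (simp add: c_def power2_eq_square field_simps)
  finally show ?thesis using L_pos by (simp add: d_def field_simps)
qed

text \<open>As the area is one, r is the mean of R, so the deviation of R from it is at most the
  oscillation.\<close>

lemma R_close_avg:
  assumes x: "x \<in> {-\<rho>..\<rho>}" and t: "0 < t"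
  shows "\<bar>R x t - r t\<bar> \<le> sqrt (L * D t)"
proof -
  define s where "s = sqrt (L * D t)"
  have osc: "\<bar>R x t - R y t\<bar> \<le> s" if "y \<in> {-\<rho>..\<rho>}" for y
    using R_osc_le[of x y t] R_osc_le[of y x t] x that t
    unfolding s_def by (cases "x \<le> y") (auto intro!: real_le_rsqrt simp: power2_commute)
  have hm: "((\<lambda>y. m y t) has_integral 1 / (2 * pi)) {-\<rho>..\<rho>}"
    using integrable_integral[OF m_integrable[OF t]] int_m'[OF t] by simp
  have hmR: "((\<lambda>y. m y t * R y t) has_integral r t / (2 * pi)) {-\<rho>..\<rho>}"
  proof -
    have "(\<lambda>y. m y t * R y t) integrable_on {-\<rho>..\<rho>}"
      using t by (intro integrable_continuous_interval continuous_intros slice_conts)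
    hence "((\<lambda>y. m y t * R y t) has_integral integral {-\<rho>..\<rho>} (\<lambda>y. m y t * R y t)) {-\<rho>..\<rho>}"
      by (rule integrable_integral)
    moreover have "integral {-\<rho>..\<rho>} (\<lambda>y. m y t * R y t) = r t / (2 * pi)"
      using int_mR[OF t] by (simp add: field_simps)
    ultimately show ?thesis by simp
  qed
  have "1 / (2 * pi) * (R x t - s) \<le> r t / (2 * pi)"
  proof (intro has_integral_le[OF has_integral_mult_left[OF hm] hmR] mult_left_mono)
    fix y assume y: "y \<in> {-\<rho>..\<rho>}"
    show "R x t - s \<le> R y t" using osc[OF y] by linarith
  qed (use m_pos in \<open>auto intro: less_imp_le\<close>)
  moreover have "r t / (2 * pi) \<le> 1 / (2 * pi) * (R x t + s)"
  proof (intro has_integral_le[OF hmR has_integral_mult_left[OF hm]] mult_left_mono)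
    fix y assume y: "y \<in> {-\<rho>..\<rho>}"
    show "R y t \<le> R x t + s" using osc[OF y] by linarith
  qed (use m_pos in \<open>auto intro: less_imp_le\<close>)
  ultimately show ?thesis unfolding s_def[symmetric] by (auto simp: divide_le_cancel abs_le_iff)
qed

text \<open>The integral of R + 2/(t-1) over the unit-area surface. By \<open>R_ge\<close> this
  integrand dominates |R|, so \<open>q\<close> bounds the L^1 norm of R.\<close>

definition q :: "real \<Rightarrow> real" where
  "q t = r t + 2 / (t - 1)"

text \<open>The term -r m R^2 is dropped because r is nonnegative. In the cubic term one factor R is
  raised to the nonnegative R + e, and R^2 is replaced by its uniform bound \<open>S\<close>; what
  remains to be integrated is m (R + e), whose integral is q / (2 pi).\<close>

lemma E'_le:
  assumes t: "1 < t"
  shows "integral {-\<rho>..\<rho>} (\<lambda>x. 2 * R x t * Q x t - (r t - R x t) * m x t * (R x t)\<^sup>2)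
    \<le> - 2 * D t + (2 * (r t)\<^sup>2 + 2 * L * D t) * q t"
proof -
  have t0: "0 < t" using t by simp
  define S where "S = 2 * (r t)\<^sup>2 + 2 * L * D t"
  define e where "e = 2 * (1 / (t - 1))"
  have S0: "0 \<le> S" using L_pos D_nonneg[OF t0] by (simp add: S_def)
  have "integral {-\<rho>..\<rho>} (\<lambda>x. 2 * R x t * Q x t - (r t - R x t) * m x t * (R x t)\<^sup>2)
    \<le> integral {-\<rho>..\<rho>} (\<lambda>x. 2 * (R x t * Q x t) + S * (m x t * R x t + e * m x t))"
  proof (rule integral_le)
    fix x assume x: "x \<in> {-\<rho>..\<rho>}"
    have "(R x t - r t)\<^sup>2 \<le> (sqrt (L * D t))\<^sup>2"
      using R_close_avg[OF x t0] by (metis abs_le_square_iff abs_of_nonneg real_sqrt_ge_zero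
          L_pos D_nonneg[OF t0] mult_nonneg_nonneg less_imp_le)
    hence dev: "(R x t - r t)\<^sup>2 \<le> L * D t" using L_pos D_nonneg[OF t0] by simp
    \<comment> \<open>The difference of the two sides is (R - 2 r)^2.\<close>
    have "(R x t)\<^sup>2 \<le> 2 * (R x t - r t)\<^sup>2 + 2 * (r t)\<^sup>2"
      using zero_le_power2[of "R x t - 2 * r t"] by (simp add: power2_eq_square algebra_simps)
    hence RS: "(R x t)\<^sup>2 \<le> S" using dev unfolding S_def by linarith
    have e0: "0 \<le> e" using t by (simp add: e_def)
    have "e / 2 = 1 / (t - 1)" unfolding e_def by (rule nonzero_mult_div_cancel_left) simp
    hence "- (e / 2) \<le> R x t" using R_ge[OF x t] by (simp only: minus_divide_left)
    hence Re: "R x t \<le> R x t + e" "0 \<le> R x t + e" using e0 by linarith+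
    have "R x t * (R x t)\<^sup>2 \<le> (R x t + e) * (R x t)\<^sup>2" using Re by (intro mult_right_mono) auto
    also have "\<dots> \<le> (R x t + e) * S" using Re RS by (intro mult_left_mono) auto
    finally have "m x t * (R x t * (R x t)\<^sup>2) \<le> m x t * ((R x t + e) * S)"
      using m_pos[OF x] by (intro mult_left_mono) (auto intro: less_imp_le)
    moreover have "0 \<le> r t * m x t * (R x t)\<^sup>2"
      using r_nonneg[OF t0] m_pos[OF x] by (intro mult_nonneg_nonneg) (auto intro: less_imp_le)
    ultimately show "2 * R x t * Q x t - (r t - R x t) * m x t * (R x t)\<^sup>2
        \<le> 2 * (R x t * Q x t) + S * (m x t * R x t + e * m x t)"
      by (simp add: algebra_simps)
  qed (use t0 in \<open>intro integrable_continuous_interval continuous_intros slice_conts; assumption\<close>)+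
  also have "\<dots> = 2 * integral {-\<rho>..\<rho>} (\<lambda>x. R x t * Q x t) +
      S * (integral {-\<rho>..\<rho>} (\<lambda>x. m x t * R x t) + e * integral {-\<rho>..\<rho>} (\<lambda>x. m x t))"
  proof (intro integral_unique has_integral_add has_integral_mult_right integrable_integral)
  qed (use t0 in \<open>intro integrable_continuous_interval continuous_intros slice_conts; assumption\<close>)+
  also have "integral {-\<rho>..\<rho>} (\<lambda>x. m x t * R x t) = r t / (2 * pi)"
    using int_mR[OF t0] by (simp add: field_simps)
  also have "2 * integral {-\<rho>..\<rho>} (\<lambda>x. R x t * Q x t) +
      S * (r t / (2 * pi) + e * integral {-\<rho>..\<rho>} (\<lambda>x. m x t)) \<le> - 2 * D t + S * q t"
  proof (intro add_mono mult_left_mono S0)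
    have "r t / (2 * pi) + e * integral {-\<rho>..\<rho>} (\<lambda>x. m x t) = q t / (2 * pi)"
      unfolding int_m'[OF t0] q_def e_def by (simp add: add_divide_distrib)
    also have "\<dots> \<le> q t / 1"
      using r_nonneg[OF t0] t pi_gt3 unfolding q_def by (intro divide_left_mono) auto
    finally show "r t / (2 * pi) + e * integral {-\<rho>..\<rho>} (\<lambda>x. m x t) \<le> q t" by simp
  qed (use int_RQ[OF t0] in simp)
  finally show ?thesis by (simp only: S_def)
qed

section \<open>Late times with small curvature\<close>

lemma r_lim: "(r \<longlongrightarrow> 0) at_top"
proof (rule tendsto_sandwich[where f = "\<lambda>_. 0" and h = "\<lambda>t. 2 * exp (Mv - Nv) / (t - 2)"])
  show "\<forall>\<^sub>F t in at_top. 0 \<le> r t"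
    using eventually_gt_at_top[of 0] by eventually_elim (rule r_nonneg)
  show "\<forall>\<^sub>F t in at_top. r t \<le> 2 * exp (Mv - Nv) / (t - 2)"
    using eventually_gt_at_top[of 2] by eventually_elim (rule r_decay)
  have "((\<lambda>t. 2 * exp (Mv - Nv) / (- 2 + t)) \<longlongrightarrow> 0) at_top"
    by (intro tendsto_divide_0[OF tendsto_const] filterlim_at_top_imp_at_infinity
        filterlim_tendsto_add_at_top[OF tendsto_const] filterlim_ident)
  thus "((\<lambda>t. 2 * exp (Mv - Nv) / (t - 2)) \<longlongrightarrow> 0) at_top" by simp
qed simp

lemma q_lim: "(q \<longlongrightarrow> 0) at_top"
proof -
  have "((\<lambda>t. 2 / (- 1 + t)) \<longlongrightarrow> (0::real)) at_top"
    by (intro tendsto_divide_0[OF tendsto_const] filterlim_at_top_imp_at_infinity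
        filterlim_tendsto_add_at_top[OF tendsto_const] filterlim_ident)
  from tendsto_add[OF r_lim this] show ?thesis by (simp add: q_def[abs_def])
qed

text \<open>If D stayed above a positive constant, E would decrease at a definite rate and become
  negative in finite time. This finds suitable times but does not say that D stays small
  afterwards.\<close>

lemma curvature_small_at_late_time:
  assumes \<delta>: "0 < \<delta>"
  shows "\<exists>t>T. \<forall>x\<in>{-\<rho>..\<rho>}. \<bar>R x t\<bar> < \<delta>"
proof -
  \<comment> \<open>Chosen so that D < \<open>\<eta>\<close> gives sqrt (L D) <
    \<open>\<delta> / 2\<close>; the other half of \<open>\<delta>\<close> is reserved for
    r.\<close>
  define \<eta> where "\<eta> = (\<delta> / 2)\<^sup>2 / L"
  have \<eta>: "0 < \<eta>" using \<delta> L_pos by (simp add: \<eta>_def)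
  \<comment> \<open>With q < 1 / (4 L) the term 2 L D q is at most D / 2; with r < 1 and q <
    \<open>\<eta> / 4\<close> the term 2 r^2 q is at most \<open>\<eta> / 2\<close>. So E' <= -3 D /
    2 + \<open>\<eta> / 2\<close>, which is at most \<open>- \<eta>\<close> as long as D >=
    \<open>\<eta>\<close>.\<close>
  have "\<forall>\<^sub>F t in at_top. t > max T 1 \<and> r t < min 1 (\<delta> / 2) \<and> q t < min (1 / (4 * L)) (\<eta> / 4)"
    using \<delta> L_pos \<eta>
    by (intro eventually_conj eventually_gt_at_top order_tendstoD(2)[OF r_lim] order_tendstoD(2)[OF q_lim]) auto
  then obtain T1 where T1: "\<And>t. t \<ge> T1 \<Longrightarrow> t > max T 1 \<and> r t < min 1 (\<delta> / 2) \<and> q t < min (1 / (4 * L)) (\<eta> / 4)"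
    unfolding eventually_at_top_linorder by blast
  have "\<exists>t\<ge>T1. D t < \<eta>"
  proof (rule ccontr)
    assume "\<not> ?thesis"
    hence D\<eta>: "\<eta> \<le> D t" if "t \<ge> T1" for t using that by force
    \<comment> \<open>At rate \<open>\<eta>\<close> the energy would be used up after time
      \<open>E T1 / \<eta>\<close>; the extra 1 pushes it strictly below zero.\<close>
    define T2 where "T2 = T1 + (E T1 / \<eta> + 1)"
    have T1p: "T1 > 1" using T1[of T1] by simp
    have "0 \<le> E T1 / \<eta>" using E_nonneg[of T1] T1p \<eta> by simp
    hence T12: "T1 \<le> T2" by (simp add: T2_def)
    define h where "h t = E t + \<eta> * t" for t
    have "h T2 \<le> h T1"
    proof (rule DERIV_nonpos_imp_nonincreasing[OF T12])
      fix t assume t: "T1 \<le> t" "t \<le> T2"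
      have t1: "1 < t" and r1: "r t < 1" and q1: "q t < 1 / (4 * L)" and q2: "q t < \<eta> / 4"
        using T1[OF t(1)] by auto
      have r0: "0 \<le> r t" using r_nonneg t1 by simp
      hence q0: "0 \<le> q t" using t1 by (simp add: q_def)
      have "2 * (r t)\<^sup>2 * q t \<le> 2 * 1 * (\<eta> / 4)"
        using r0 r1 q0 q2 by (intro mult_mono) (auto simp: power_le_one)
      moreover have "2 * L * D t * q t \<le> 2 * L * D t * (1 / (4 * L))"
        using q1 L_pos D_nonneg[of t] t1 by (intro mult_left_mono) auto
      moreover have "2 * L * D t * (1 / (4 * L)) = D t / 2" using L_pos by simp
      ultimately have "- 2 * D t + (2 * (r t)\<^sup>2 + 2 * L * D t) * q t + \<eta> \<le> 0"
        using D\<eta>[OF t(1)] by (simp add: distrib_right)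
      hence "integral {-\<rho>..\<rho>} (\<lambda>x. 2 * R x t * Q x t - (r t - R x t) * m x t * (R x t)\<^sup>2) + \<eta> \<le> 0"
        using E'_le[OF t1] by linarith
      moreover have "(h has_real_derivative
         integral {-\<rho>..\<rho>} (\<lambda>x. 2 * R x t * Q x t - (r t - R x t) * m x t * (R x t)\<^sup>2) + \<eta>) (at t)"
        unfolding h_def using t1 by (intro DERIV_add E_dt DERIV_cmult_Id) auto
      ultimately show "\<exists>y. (h has_real_derivative y) (at t) \<and> y \<le> 0" by blast
    qed
    hence "E T2 \<le> E T1 - \<eta> * (T2 - T1)" by (simp add: h_def algebra_simps)
    also have "\<dots> = - \<eta>" using \<eta> by (simp add: T2_def field_simps)
    finally show False using E_nonneg[of T2] T12 T1p \<eta> by simp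
  qed
  then obtain t where t: "t \<ge> T1" "D t < \<eta>" by blast
  have t0: "0 < t" and rt: "r t < \<delta> / 2" and tT: "t > T" using T1[OF t(1)] by auto
  have "L * D t < (\<delta> / 2)\<^sup>2" using t(2) L_pos by (simp add: \<eta>_def field_simps)
  hence "sqrt (L * D t) < \<delta> / 2" using \<delta> real_sqrt_less_mono by fastforce
  hence "\<bar>R x t\<bar> < \<delta>" if "x \<in> {-\<rho>..\<rho>}" for x
    using R_close_avg[OF that t0] rt r_nonneg[OF t0] by linarith
  thus ?thesis using tT by blast
qed

end

section \<open>From the geometric flow to the locale\<close>

lemma smooth_partials:
  assumes D: "\<And>i j p. p \<in> U \<Longrightarrow> ((\<lambda>q. D i j (fst q) (snd q)) has_derivative
      (\<lambda>q. fst q * D (Suc i) j (fst p) (snd p) + snd q * D i (Suc j) (fst p) (snd p))) (at p)"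
    and xt: "(x, t) \<in> U"
  shows smooth_dx: "((\<lambda>x. D i j x t) has_real_derivative D (Suc i) j x t) (at x)"
    and smooth_dt: "(D i j x has_real_derivative D i (Suc j) x t) (at t)"
proof -
  have "((\<lambda>x. (x, t)) has_derivative (\<lambda>h. (h, 0))) (at x)"
    by (auto intro!: derivative_eq_intros)
  from has_derivative_compose[OF this D[OF xt]]
  show "((\<lambda>x. D i j x t) has_real_derivative D (Suc i) j x t) (at x)"
    by (simp add: has_field_derivative_def mult_commute_abs)
  have "((\<lambda>t. (x, t)) has_derivative (\<lambda>h. (0, h))) (at t)"
    by (auto intro!: derivative_eq_intros)
  from has_derivative_compose[OF this D[OF xt]]
  show "(D i j x has_real_derivative D i (Suc j) x t) (at t)"
    by (simp add: has_field_derivative_def mult_commute_abs)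
qed

text \<open>With A = e^u and B = e^u f the exponential cancels in B' / A, leaving f u_x + f'. The
  first derivatives are required on a neighbourhood because \<open>rs_scal\<close> nests one
  \<open>deriv\<close> inside another.\<close>

lemma rs_scal_conformal:
  assumes f: "\<forall>\<^sub>F s in nhds x. (f has_real_derivative f1 s) (at s)"
    and u: "\<forall>\<^sub>F s in nhds x. ((\<lambda>s. u s t) has_real_derivative ux s) (at s)"
    and f1: "(f1 has_real_derivative f2) (at x)" and ux: "(ux has_real_derivative uxx) (at x)"
  shows deriv_gB: "deriv (gB f u t) x = exp (u x t) * (f x * ux x + f1 x)"
    and flow_scal_eq: "flow_scal f u x t = - 2 * (f1 x * ux x + f x * uxx + f2) / (exp (2 * u x t) * f x)"
proof -
  have "\<forall>\<^sub>F s in nhds x. deriv (gB f u t) s = exp (u s t) * (f s * ux s + f1 s)"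
    using f u
  proof eventually_elim
    case (elim s)
    have "(gB f u t has_real_derivative exp (u s t) * (f s * ux s + f1 s)) (at s)"
      unfolding gB_def using elim by (auto intro!: derivative_eq_intros simp: algebra_simps)
    thus ?case by (rule DERIV_imp_deriv)
  qed
  note ev = this
  show "deriv (gB f u t) x = exp (u x t) * (f x * ux x + f1 x)"
    using eventually_nhds_x_imp_x[OF ev] .
  have "deriv (\<lambda>s. deriv (gB f u t) s / gA u t s) x = deriv (\<lambda>s. f s * ux s + f1 s) x"
    using ev by (intro deriv_cong_ev) (auto elim!: eventually_mono simp: gA_def)
  also have "\<dots> = f1 x * ux x + f x * uxx + f2"
    using eventually_nhds_x_imp_x[OF f] f1 ux
    by (intro DERIV_imp_deriv) (auto intro!: derivative_eq_intros simp: algebra_simps)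
  finally have "deriv (\<lambda>s. deriv (gB f u t) s / gA u t s) x = f1 x * ux x + f x * uxx + f2" .
  moreover have "gA u t x * gB f u t x = exp (2 * u x t) * f x"
    by (simp add: gA_def gB_def exp_double power2_eq_square)
  ultimately show "flow_scal f u x t = - 2 * (f1 x * ux x + f x * uxx + f2) / (exp (2 * u x t) * f x)"
    unfolding flow_scal_def rs_scal_def by (simp only: times_divide_eq_left)
qed

theorem theorem4p6:
  fixes \<rho> :: real and f :: "real \<Rightarrow> real" and u :: "real \<Rightarrow> real \<Rightarrow> real" and \<phi> :: "real \<Rightarrow> real"
  assumes rho_pos: "\<rho> > 0"
    and f_smooth: "\<exists>U. open U \<and> {-\<rho>..\<rho>} \<subseteq> U \<and> smooth1_on U f"
    and f_pos: "\<forall>r\<in>{-\<rho>..\<rho>}. f r > 0"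
    and area: "rs_area (\<lambda>_. 1) f \<rho> = 1"
    and R_nonneg: "\<forall>r\<in>{-\<rho>..\<rho>}. rs_scal (\<lambda>_. 1) f r \<ge> 0"
    and k_top: "rs_geod_top (\<lambda>_. 1) f \<rho> \<le> 0"
    and k_bot: "rs_geod_bot (\<lambda>_. 1) f \<rho> \<le> 0"
    and refl: "\<forall>r\<in>{-\<rho>..\<rho>}. f (- r) = f r"
    and decr: "\<forall>r1\<in>{-\<rho>..\<rho>}. \<forall>r2\<in>{-\<rho>..\<rho>}. \<bar>r1\<bar> \<le> \<bar>r2\<bar> \<longrightarrow>
                  rs_scal (\<lambda>_. 1) f r2 \<le> rs_scal (\<lambda>_. 1) f r1"
    and flow: "normalised_flow \<rho> f u \<phi>"
  shows "\<exists>tk :: nat \<Rightarrow> real. filterlim tk at_top sequentially \<and>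
           ((\<lambda>k. SUP r\<in>{-\<rho>..\<rho>}. flow_scal f u r (tk k)) \<longlongrightarrow> 0) sequentially"
proof -
  let ?I = "{-\<rho>..\<rho>}"
  let ?r = "flow_total_scal \<rho> f u"
  obtain V F where V: "open V" "?I \<subseteq> V" and F0: "F 0 = f"
    and F: "\<And>k x. x \<in> V \<Longrightarrow> (F k has_real_derivative F (Suc k) x) (at x)"
    using f_smooth unfolding smooth1_on_def by blast
  define f1 where "f1 = F 1"
  define f2 where "f2 = F 2"
  have f_dx: "(f has_real_derivative f1 x) (at x)" and f1_dx: "(f1 has_real_derivative f2 x) (at x)"
    and f2_dx: "(f2 has_real_derivative F 3 x) (at x)" if "x \<in> V" for x
    using F[OF that, of 0] F[OF that, of 1] F[OF that, of 2]
    by (simp_all add: f1_def f2_def F0 numeral_eq_Suc)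
  obtain U where U: "open U" "?I \<times> {0<..} \<subseteq> U" and "smooth2_on U u"
    using flow unfolding normalised_flow_def by auto
  then obtain D where D0: "D 0 0 = u"
    and D: "\<And>i j p. p \<in> U \<Longrightarrow> ((\<lambda>q. D i j (fst q) (snd q)) has_derivative
      (\<lambda>q. fst q * D (Suc i) j (fst p) (snd p) + snd q * D i (Suc j) (fst p) (snd p))) (at p)"
    unfolding smooth2_on_def by blast
  have D_dx: "((\<lambda>x. D i j x t) has_real_derivative D (Suc i) j x t) (at x)"
    and D_dt: "(D i j x has_real_derivative D i (Suc j) x t) (at t)" if "(x, t) \<in> U" for i j x t
    using smooth_partials[of U D, OF D that] by auto
  have D_cont: "continuous_on (?I \<times> {0<..}) (\<lambda>p. D i j (fst p) (snd p))" for i j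
    using U(2) by (intro has_derivative_continuous_on[OF has_derivative_at_withinI[OF D]]) auto
  \<comment> \<open>At x = \<open>\<rho>\<close> or x = \<open>-\<rho>\<close> a full neighbourhood
    leaves the cylinder; the open sets \<open>V\<close> and \<open>U\<close> on which f and u are
    smooth make room for it.\<close>
  have near: "\<forall>\<^sub>F s in nhds x. s \<in> V \<and> (s, t) \<in> U" if "x \<in> ?I" "0 < t" for x t
  proof (intro eventually_conj)
    show "\<forall>\<^sub>F s in nhds x. s \<in> V" using V that by (intro eventually_nhds_in_open) auto
    have "open ((\<lambda>s. (s, t)) -` U)"
      using U(1) by (intro open_vimage) (auto intro!: continuous_intros)
    from eventually_nhds_in_open[OF this, of x] show "\<forall>\<^sub>F s in nhds x. (s, t) \<in> U"
      using subsetD[OF U(2), of "(x, t)"] that by auto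
  qed
  have conformal:
    "deriv (gB f u t) x = exp (u x t) * (f x * D 1 0 x t + f1 x)"
    "flow_scal f u x t = - 2 * (f1 x * D 1 0 x t + f x * D 2 0 x t + f2 x) / (exp (2 * u x t) * f x)"
    if "x \<in> ?I" "0 < t" for x t
  proof -
    have xU: "(x, t) \<in> U" "x \<in> V" using that U V by auto
    have "\<forall>\<^sub>F s in nhds x. (f has_real_derivative f1 s) (at s)"
      using near[OF that] by eventually_elim (auto intro: f_dx)
    moreover have "\<forall>\<^sub>F s in nhds x. ((\<lambda>s. u s t) has_real_derivative D 1 0 s t) (at s)"
      using near[OF that] by eventually_elim (use D_dx[of _ t 0 0] in \<open>auto simp: D0\<close>)
    moreover have "((\<lambda>s. D 1 0 s t) has_real_derivative D 2 0 x t) (at x)"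
      using D_dx[OF xU(1), of 1 0] by (simp add: numeral_2_eq_2)
    ultimately show "deriv (gB f u t) x = exp (u x t) * (f x * D 1 0 x t + f1 x)"
    "flow_scal f u x t = - 2 * (f1 x * D 1 0 x t + f x * D 2 0 x t + f2 x) / (exp (2 * u x t) * f x)"
      using deriv_gB[OF _ _ f1_dx[OF xU(2)]] flow_scal_eq[OF _ _ f1_dx[OF xU(2)]] by auto
  qed
  have geod0: "rs_geod_top (\<lambda>_. 1) f \<rho> = f1 \<rho> / f \<rho>" "rs_geod_bot (\<lambda>_. 1) f \<rho> = - f1 (-\<rho>) / f (-\<rho>)"
    using DERIV_imp_deriv[OF f_dx] subsetD[OF V(2), of \<rho>] subsetD[OF V(2), of "-\<rho>"] rho_pos
    by (simp_all add: rs_geod_top_def rs_geod_bot_def)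
  have area_eq: "exp (u x t) * (exp (u x t) * f x) = exp (2 * u x t) * f x" for x t
    by (simp add: exp_double power2_eq_square)
  \<comment> \<open>\<open>D i j\<close> is indexed by the number of derivatives in each variable,
    so \<open>D 1 1\<close> and \<open>D 2 1\<close> satisfy both the spatial and the temporal
    requirement on mixed derivatives.\<close>
  interpret cylinder_flow \<rho> f f1 f2 u "D 1 0" "D 2 0" "D 0 1" "D 1 1" "D 2 1" \<phi> ?r
  proof
    fix x t :: real
    show "0 < \<rho>" by fact
    show "continuous_on ?I f2"
      using DERIV_continuous_on[of ?I f2 "F 3"] f2_dx V(2) by (meson has_field_derivative_at_within subsetD)
    show "f1 \<rho> \<le> 0" "0 \<le> f1 (-\<rho>)"
      using k_top k_bot bspec[OF f_pos, of \<rho>] bspec[OF f_pos, of "-\<rho>"] rho_pos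
      unfolding geod0 by (simp_all add: divide_le_0_iff zero_le_divide_iff)
    { assume x: "x \<in> ?I"
      thus "0 < f x" using f_pos by blast
      have xV: "x \<in> V" using V x by blast
      show "(f has_real_derivative f1 x) (at x within ?I)" "(f1 has_real_derivative f2 x) (at x within ?I)"
        using f_dx[OF xV] f1_dx[OF xV] by (auto intro: has_field_derivative_at_within)
      assume t: "0 < t"
      have xU: "(x, t) \<in> U" using U x t by auto
      note dx = D_dx[OF xU, THEN has_field_derivative_at_within]
      show "((\<lambda>x. u x t) has_real_derivative D 1 0 x t) (at x within ?I)"
        "((\<lambda>x. D 1 0 x t) has_real_derivative D 2 0 x t) (at x within ?I)"
        "((\<lambda>x. D 0 1 x t) has_real_derivative D 1 1 x t) (at x within ?I)"
        "((\<lambda>x. D 1 1 x t) has_real_derivative D 2 1 x t) (at x within ?I)"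
        using dx[of 0 0] dx[of 1 0] dx[of 0 1] dx[of 1 1] by (simp_all add: D0 numeral_2_eq_2)
      show ut: "(u x has_real_derivative D 0 1 x t) (at t)"
        and "(D 1 0 x has_real_derivative D 1 1 x t) (at t)"
        and "(D 2 0 x has_real_derivative D 2 1 x t) (at t)"
        using D_dt[OF xU, of 0 0] D_dt[OF xU, of 1 0] D_dt[OF xU, of 2 0] by (simp_all add: D0)
      have "2 * deriv (u x) t = ?r t - flow_scal f u x t"
        using flow x t unfolding normalised_flow_def by simp
      thus "2 * D 0 1 x t = ?r t +
          2 * (f1 x * D 1 0 x t + f x * D 2 0 x t + f2 x) / (exp (2 * u x t) * f x)"
        unfolding DERIV_imp_deriv[OF ut] conformal(2)[OF x t]
        by (simp only: mult_minus_left divide_minus_left diff_minus_eq_add)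
    }
    show "continuous_on (?I \<times> {0<..}) (\<lambda>p. u (fst p) (snd p))" using D_cont[of 0 0] by (simp add: D0)
    assume t: "0 < t"
    show "0 < \<phi> t" "(\<phi> has_real_derivative ?r t * \<phi> t) (at t)"
      using flow t unfolding normalised_flow_def by auto
    have "rs_area (gA u t) (gB f u t) \<rho> = 1" using flow t unfolding normalised_flow_def by auto
    thus "2 * pi * integral ?I (\<lambda>x. exp (2 * u x t) * f x) = 1"
      by (simp add: rs_area_def gA_def gB_def area_eq)
    have "integral ?I (\<lambda>x. - 2 * (f1 x * D 1 0 x t + f x * D 2 0 x t + f2 x)) =
        integral ?I (\<lambda>x. rs_scal (gA u t) (gB f u t) x * gA u t x * gB f u t x)"
    proof (rule integral_cong)
      fix x assume x: "x \<in> ?I"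
      have "rs_scal (gA u t) (gB f u t) x * gA u t x * gB f u t x =
          flow_scal f u x t * (exp (2 * u x t) * f x)"
        by (simp add: flow_scal_def gA_def gB_def mult.assoc area_eq)
      also have "\<dots> = - 2 * (f1 x * D 1 0 x t + f x * D 2 0 x t + f2 x)"
        unfolding conformal(2)[OF x t] using f_pos x by force
      finally show "- 2 * (f1 x * D 1 0 x t + f x * D 2 0 x t + f2 x) =
          rs_scal (gA u t) (gB f u t) x * gA u t x * gB f u t x" ..
    qed
    thus "2 * pi * integral ?I (\<lambda>x. - 2 * (f1 x * D 1 0 x t + f x * D 2 0 x t + f2 x)) = ?r t"
      unfolding flow_total_scal_def rs_total_scal_def by simp
    assume x: "x = \<rho> \<or> x = -\<rho>"
    hence xI: "x \<in> ?I" using rho_pos by auto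
    have "deriv (gB f u t) x / (gA u t x * gB f u t x) = f1 x / f x / sqrt (\<phi> t)"
    proof -
      have "rs_geod_top (gA u t) (gB f u t) \<rho> = f1 \<rho> / f \<rho> / sqrt (\<phi> t)"
        "rs_geod_bot (gA u t) (gB f u t) \<rho> = - f1 (-\<rho>) / f (-\<rho>) / sqrt (\<phi> t)"
        using flow t unfolding normalised_flow_def geod0 by auto
      thus ?thesis using x unfolding rs_geod_top_def rs_geod_bot_def by auto
    qed
    hence "(f x * D 1 0 x t + f1 x) / (exp (u x t) * f x) = f1 x / f x / sqrt (\<phi> t)"
      unfolding conformal(1)[OF xI t] by (simp add: gA_def gB_def)
    thus "f x * D 1 0 x t + f1 x = f1 x * exp (u x t) / sqrt (\<phi> t)"
      using bspec[OF f_pos xI] by (simp add: field_simps)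
  qed (use D_cont in auto)
  have R_flow: "R x t = flow_scal f u x t" if "x \<in> ?I" "0 < t" for x t
    unfolding conformal(2)[OF that] R_def m_def ..
  have "\<exists>t>real k. \<forall>x\<in>?I. \<bar>R x t\<bar> < inverse (real (Suc k))" for k
    by (rule curvature_small_at_late_time) simp
  then obtain tk where tk: "\<And>k. tk k > real k"
    "\<And>k x. x \<in> ?I \<Longrightarrow> \<bar>R x (tk k)\<bar> < inverse (real (Suc k))" by metis
  have tk_pos: "0 < tk k" for k using tk(1)[of k] by linarith
  show ?thesis
  proof (intro exI conjI)
    show "filterlim tk at_top sequentially"
      by (rule filterlim_at_top_mono[OF filterlim_real_sequentially])
        (intro always_eventually allI less_imp_le tk(1))
    show "((\<lambda>k. SUP x\<in>?I. flow_scal f u x (tk k)) \<longlongrightarrow> 0) sequentially"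
    proof (rule Lim_null_comparison[OF _ LIMSEQ_inverse_real_of_nat], intro always_eventually allI)
      fix k
      have b: "\<bar>flow_scal f u x (tk k)\<bar> \<le> inverse (real (Suc k))" if "x \<in> ?I" for x
        using tk(2)[OF that, of k] R_flow[OF that tk_pos] by simp
      \<comment> \<open>A bound on |R| controls the supremum from both sides; the interval is
        nonempty because \<open>\<rho>\<close> is positive.\<close>
      have "\<bar>SUP x\<in>?I. flow_scal f u x (tk k)\<bar> \<le> inverse (real (Suc k))"
        using b rho_pos by (intro cSup_abs_le) auto
      thus "norm (SUP x\<in>?I. flow_scal f u x (tk k)) \<le> inverse (real (Suc k))" by simp
    qed
  qed
qed

end
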